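(* (a) $\displaystyle\lim_{n\to+\infty}\gamma(S_n)=\lim_{n\to+\infty}\gamma(A_n)=+\infty$. In particular, for every integer $k\geq 2$, the equation $\gamma(S_n)=k$ has only finitely many solutions $n$, and the equation $\gamma(A_n)=k$ has only finitely many solutions $n$. (b) $\displaystyle\limsup_{n\to+\infty}\,[\gamma(S_n)-\gamma(A_n)]=+\infty$.
   Context: $S_n$ and $A_n$ denote the symmetric and alternating groups on $\{1,\dots,n\}$. For a finite group $G$, a basic set for $G$ is a set $\{H_1,\dots,H_k\}$ of pairwise non-conjugate proper subgroups of $G$ such that $G=\bigcup_{i=1}^k\bigcup_{g\in G}H_i^g$. A basic set exists if and only if $G$ is non-cyclic. For non-cyclic finite $G$, $\gamma(G)$ denotes the smallest size of a basic set for $G$ (so $\gamma(S_n)$ is defined for $n\ge 3$ and $\gamma(A_n)$ for $n\geq 4$). *)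

theory Defs
  imports "HOL-Algebra.Sym_Groups" "HOL-Library.Extended_Real"
begin

definition conj_subgroup :: "('a, 'b) monoid_scheme \<Rightarrow> 'a set \<Rightarrow> 'a \<Rightarrow> 'a set" where
  "conj_subgroup G H g = inv\<^bsub>G\<^esub> g <#\<^bsub>G\<^esub> (H #>\<^bsub>G\<^esub> g)"

definition basic_set :: "('a, 'b) monoid_scheme \<Rightarrow> 'a set set \<Rightarrow> bool" where
  "basic_set G B \<longleftrightarrow>
     finite B \<and>
     (\<forall>H\<in>B. subgroup H G \<and> H \<noteq> carrier G) \<and>
     (\<forall>H\<in>B. \<forall>K\<in>B. H \<noteq> K \<longrightarrow> \<not> (\<exists>g\<in>carrier G. K = conj_subgroup G H g)) \<and>
     carrier G = (\<Union>H\<in>B. \<Union>g\<in>carrier G. conj_subgroup G H g)"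

(* A finite group has a basic set iff it is non-cyclic; in the remaining cases the value
   below is the unspecified LEAST of an empty predicate and carries no meaning. *)
definition gamma_num :: "('a, 'b) monoid_scheme \<Rightarrow> nat" where
  "gamma_num G = (LEAST k. \<exists>B. basic_set G B \<and> card B = k)"

end

(* A proper subgroup H of S_n or A_n that contains an element x is intransitive, hence has an invariant
   set whose size is a partial sum of the cycle lengths of x, unless H is imprimitive or contains A_n.
   So many elements x with essentially disjoint sets of partial sums force many members in a basic set.

   H is primitive and contains A_n as soon as it is transitive and x is one of the following.
   - x has cycle lengths (p, a, b), b possibly 0, where p is a small prime dividing neither n nor a and,
     if b > 0, p does not divide b, and p + a, p + b do not divide n.  For (a): p is any small prime not dividing
     (n - 1) n (n + 1), and (a, b) is (n - p, 0) or the two halves of n - p, whichever gives x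
     the parity required for x to lie outside A_n (for S_n) or inside A_n (for A_n).
   - n is prime and x has cycle lengths (k, n - k), 2 <= k < n / 2.  For (b): this gives
     gamma(S_n) >= (n - 3) / 2, whereas gamma(A_n) <= n / 3 + 2 for odd n, because an even permutation
     of an odd number of points is an n-cycle or has an invariant set of size at most n / 3.

   The underlying Jordan-type theorem: let a primitive group have a set T of size k <= (n + 1) / 2 on
   which the pointwise stabilizer of the complement is transitive.  If k is prime (or the complement
   has the same property and k is coprime to n), then every k-set has this property; two such sets
   meeting in one point give a 3-cycle as a commutator, and the theorem for k = 3 gives all 3-cycles. *)

theory Submission
  imports Defs "HOL-Computational_Algebra.Squarefree" "HOL-Library.Discrete_Functions"
begin

section \<open>Jordan sets of primitive permutation groups\<close>

text \<open>Bare sets of functions instead of monoid records make images of point sets direct and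
  treat subgroups of S_n and of A_n alike.\<close>

locale perm_group =
  fixes W :: "'a set" and G :: "('a \<Rightarrow> 'a) set"
  assumes finite_W [simp, intro]: "finite W"
    and permutes_W: "g \<in> G \<Longrightarrow> g permutes W"
    and id_G [simp, intro]: "id \<in> G"
    and comp_G [intro]: "g \<in> G \<Longrightarrow> h \<in> G \<Longrightarrow> g \<circ> h \<in> G"
    and inv_G [intro]: "g \<in> G \<Longrightarrow> inv' g \<in> G"
begin

lemma bij_G: "g \<in> G \<Longrightarrow> bij g"
  using permutes_W permutes_bij by blast

lemma inj_G: "g \<in> G \<Longrightarrow> inj g"
  using bij_G bij_is_inj by blast

lemma card_image_G: "g \<in> G \<Longrightarrow> card (g ` A) = card A"
  by (intro card_image inj_on_subset[OF inj_G]) auto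

lemma image_subset_W: "g \<in> G \<Longrightarrow> A \<subseteq> W \<Longrightarrow> g ` A \<subseteq> W"
  using permutes_W permutes_image image_mono by metis

lemma inv_image_G: "g \<in> G \<Longrightarrow> inv' g ` (g ` A) = A"
  using inj_G by (simp add: image_comp)

lemma image_inv_G: "g \<in> G \<Longrightarrow> g ` (inv' g ` A) = A"
  by (simp add: bij_G bij_is_surj image_f_inv_f)

lemma funpow_G: "g \<in> G \<Longrightarrow> g ^^ n \<in> G"
  by (induction n) (auto simp: id_def[symmetric])

section \<open>Blocks, primitivity and Jordan sets\<close>

definition block :: "'a set \<Rightarrow> bool" where
  "block A \<longleftrightarrow> (\<forall>g\<in>G. g ` A = A \<or> g ` A \<inter> A = {})"

text \<open>Transitivity is implied once W has at least three points: a nontrivial orbit is a block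
  of size at least 2, and under a trivial action every pair of points is a block.\<close>

definition primitive :: bool where
  "primitive \<longleftrightarrow> (\<forall>A\<subseteq>W. block A \<and> 2 \<le> card A \<longrightarrow> A = W)"

text \<open>For T = W this is transitivity of the group, which is expressed as
  \<open>jordan W\<close> throughout.\<close>

definition jordan :: "'a set \<Rightarrow> bool" where
  "jordan T \<longleftrightarrow> T \<subseteq> W \<and>
     (\<forall>x\<in>T. \<forall>y\<in>T. \<exists>h\<in>G. h x = y \<and> (\<forall>z. z \<notin> T \<longrightarrow> h z = z))"

lemma jordanD:
  assumes "jordan T" "x \<in> T" "y \<in> T"
  obtains h where "h \<in> G" "h x = y" "\<And>z. z \<notin> T \<Longrightarrow> h z = z" "h permutes T"
proof -
  obtain h where h: "h \<in> G" "h x = y" "\<forall>z. z \<notin> T \<longrightarrow> h z = z"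
    using assms unfolding jordan_def by blast
  then have "h permutes T"
    using bij_G[of h] by (simp add: permutes_def bij_iff)
  with h show ?thesis using that by blast
qed

lemma jordan_image:
  assumes "jordan T" "g \<in> G"
  shows "jordan (g ` T)"
  unfolding jordan_def
proof (intro conjI ballI)
  show "g ` T \<subseteq> W"
    using assms image_subset_W unfolding jordan_def by blast
next
  fix x y assume "x \<in> g ` T" "y \<in> g ` T"
  then obtain u v where uv: "u \<in> T" "v \<in> T" "x = g u" "y = g v" by blast
  obtain h where h: "h \<in> G" "h u = v" "\<And>z. z \<notin> T \<Longrightarrow> h z = z"
    using jordanD[OF assms(1) uv(1,2)] by metis
  let ?k = "g \<circ> h \<circ> inv' g"
  have "?k \<in> G" using h assms by blast
  moreover have "?k x = y"
    using uv h inj_G[OF assms(2)] by simp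
  moreover have "?k z = z" if "z \<notin> g ` T" for z
  proof -
    have "g (inv' g z) = z" using bij_G[OF assms(2)] by (simp add: bij_is_surj surj_f_inv_f)
    with that have "inv' g z \<notin> T" by force
    then show ?thesis using h(3) \<open>g (inv' g z) = z\<close> by simp
  qed
  ultimately show "\<exists>h\<in>G. h x = y \<and> (\<forall>z. z \<notin> g ` T \<longrightarrow> h z = z)" by blast
qed

text \<open>The images of A under the elements supported on T partition T: transitivity on T gives
  the covering, \<open>blk\<close> the disjointness. The lemma serves T = W, with A a block, and
  smaller T, where A need only behave like a block under the elements supported on T.\<close>

lemma card_block_dvd:
  assumes J: "jordan T" and A: "A \<subseteq> T" "A \<noteq> {}"
    and blk: "\<And>h. h \<in> G \<Longrightarrow> h permutes T \<Longrightarrow> h ` A = A \<or> h ` A \<inter> A = {}"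
  shows "card A dvd card T"
proof -
  define C where "C = (\<lambda>h. h ` A) ` {h \<in> G. h permutes T}"
  have fT: "finite T" using J finite_subset finite_W unfolding jordan_def by blast
  have sub: "c \<subseteq> T" if "c \<in> C" for c
    using that A(1) unfolding C_def by (auto simp: permutes_in_image)
  have "\<Union>C = T"
  proof
    show "\<Union>C \<subseteq> T" using sub by blast
    show "T \<subseteq> \<Union>C"
    proof
      fix y assume "y \<in> T"
      obtain a where "a \<in> A" using A(2) by blast
      then obtain h where "h \<in> G" "h a = y" "h permutes T"
        using jordanD[OF J, of a y] \<open>y \<in> T\<close> A(1) by blast
      then show "y \<in> \<Union>C" using \<open>a \<in> A\<close> unfolding C_def by blast
    qed
  qed
  moreover have "card A * card C = card (\<Union>C)"
  proof (rule card_partition)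
    show "finite C" using sub fT by (meson finite_Pow_iff finite_subset PowI subsetI)
    show "finite (\<Union>C)" using \<open>\<Union>C = T\<close> fT by simp
    show "card c = card A" if "c \<in> C" for c
      using that card_image_G unfolding C_def by blast
    show "c1 \<inter> c2 = {}" if c12: "c1 \<in> C" "c2 \<in> C" "c1 \<noteq> c2" for c1 c2
    proof -
      obtain h k where h: "h \<in> G" "h permutes T" "c1 = h ` A" and k: "k \<in> G" "k permutes T" "c2 = k ` A"
        using c12(1,2) unfolding C_def by blast
      have "inv' k \<circ> h \<in> G" "inv' k \<circ> h permutes T"
        using h k by (auto intro: permutes_compose permutes_inv)
      then have "(inv' k \<circ> h) ` A = A \<or> (inv' k \<circ> h) ` A \<inter> A = {}" by (rule blk)
      then show ?thesis
      proof
        assume "(inv' k \<circ> h) ` A = A"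
        then have "k ` (inv' k ` h ` A) = k ` A" by (simp add: image_comp)
        then have "h ` A = k ` A" using image_inv_G[OF k(1)] by simp
        then show ?thesis using c12(3) h k by simp
      next
        assume *: "(inv' k \<circ> h) ` A \<inter> A = {}"
        show ?thesis
        proof (rule ccontr)
          assume "c1 \<inter> c2 \<noteq> {}"
          then obtain a b where "a \<in> A" "b \<in> A" "h a = k b" using h k by blast
          then have "(inv' k \<circ> h) a = b" using inj_G[OF k(1)] by simp
          then show False using * \<open>a \<in> A\<close> \<open>b \<in> A\<close> by blast
        qed
      qed
    qed
  qed
  ultimately show ?thesis by (metis dvd_triv_left)
qed

text \<open>The hypothesis \<open>moves\<close> lets one enlarge \<open>card (g ` S \<inter> S)\<close> as long as \<open>g ` S\<close> misses two
  points of \<open>S\<close>, so the maximal intersection has \<open>card S - 1\<close> points.\<close>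

lemma exchange:
  assumes prim: "primitive" and S: "S \<subseteq> W" "2 \<le> card S" "S \<noteq> W"
    and moves: "\<And>A B. A \<subset> S \<Longrightarrow> B \<subseteq> W - S \<Longrightarrow> card A = card B \<Longrightarrow> 2 \<le> card A \<Longrightarrow>
      \<exists>h\<in>G. h ` S = S \<and> (h ` A \<noteq> A \<and> h ` A \<inter> A \<noteq> {} \<and> h ` B = B \<or>
                           h ` A = A \<and> h ` B \<noteq> B \<and> h ` B \<inter> B \<noteq> {})"
  obtains g a b where "g \<in> G" "a \<in> S" "b \<in> W - S" "g ` S = insert b (S - {a})"
proof -
  have fS: "finite S" using S finite_subset finite_W by blast
  define P where "P g \<longleftrightarrow> g \<in> G \<and> g ` S \<noteq> S \<and> g ` S \<inter> S \<noteq> {}" for g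
  have "\<not> block S" using prim S unfolding primitive_def by blast
  then have "\<exists>g. P g"
    unfolding block_def P_def by auto
  moreover have "card (g ` S \<inter> S) \<le> card S" for g
    using fS by (simp add: card_mono)
  \<comment> \<open>S is not a block, so some image of S meets S without equalling it; g is chosen
    with the largest intersection.\<close>
  ultimately obtain g where g: "P g" and gmax: "\<And>h. P h \<Longrightarrow> card (h ` S \<inter> S) \<le> card (g ` S \<inter> S)"
    using ex_has_greatest_nat[of P _ "\<lambda>g. card (g ` S \<inter> S)" "Suc (card S)"] by (metis less_Suc_eq_le)
  have gG: "g \<in> G" using g P_def by blast
  define I where "I = g ` S \<inter> S"
  define A where "A = S - g ` S"
  define B where "B = g ` S - S"
  have cg: "card (g ` S) = card S" using card_image_G gG by blast
  have fg: "finite (g ` S)" using fS by blast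
  have IA: "S = I \<union> A" "I \<inter> A = {}" and IB: "g ` S = I \<union> B" "I \<inter> B = {}"
    unfolding I_def A_def B_def by auto
  have fin: "finite I" "finite A" "finite B" unfolding I_def A_def B_def using fS fg by auto
  have cA: "card S = card I + card A" using IA fin by (metis card_Un_disjoint)
  have cB: "card S = card I + card B" using IB fin cg by (metis card_Un_disjoint)
  have ceq: "card A = card B" using cA cB by simp
  have A0: "A \<noteq> {}"
  proof
    assume "A = {}"
    then have "S \<subseteq> g ` S" unfolding A_def by blast
    then have "S = g ` S" using cg fg by (simp add: card_subset_eq)
    then show False using g unfolding P_def by simp
  qed
  have I0: "I \<noteq> {}" using g unfolding P_def I_def by blast
  have BW: "B \<subseteq> W - S" using image_subset_W[OF gG S(1)] unfolding B_def by blast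
  have "card A = 1"
  proof (rule ccontr)
    assume "card A \<noteq> 1"
    then have "2 \<le> card A" using A0 fin by (metis One_nat_def Suc_1 Suc_leI card_gt_0_iff le_neq_implies_less)
    moreover have "A \<subset> S" using IA I0 by blast
    ultimately have "\<exists>h\<in>G. h ` S = S \<and> (h ` A \<noteq> A \<and> h ` A \<inter> A \<noteq> {} \<and> h ` B = B \<or>
                           h ` A = A \<and> h ` B \<noteq> B \<and> h ` B \<inter> B \<noteq> {})"
      by (intro moves[OF _ BW ceq])
    then obtain h where h: "h \<in> G" "h ` S = S"
      and hh: "h ` A \<noteq> A \<and> h ` A \<inter> A \<noteq> {} \<and> h ` B = B \<or> h ` A = A \<and> h ` B \<noteq> B \<and> h ` B \<inter> B \<noteq> {}"
      by (elim bexE conjE)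
    have ih: "inj h" using inj_G h by blast
    have hI: "h ` I = S - h ` A"
    proof -
      have "I = S - A" using IA by blast
      then have "h ` I = h ` S - h ` A" using image_set_diff[OF ih] by simp
      then show ?thesis using h(2) by simp
    qed
    have hIB: "h ` I \<inter> B = {}" "h ` B \<inter> I = {}" "h ` B \<inter> S = {}"
    proof -
      show "h ` I \<inter> B = {}" using hI unfolding B_def by blast
      have "h ` B \<inter> h ` S = {}" using ih unfolding B_def by (auto dest: injD)
      then show "h ` B \<inter> S = {}" using h(2) by simp
      then show "h ` B \<inter> I = {}" using IA by blast
    qed
    have split: "h ` g ` S \<inter> g ` S = (h ` I \<inter> I) \<union> (h ` B \<inter> B)"
      using IB(1) hIB by (auto simp: image_Un)
    have dj: "(h ` I \<inter> I) \<inter> (h ` B \<inter> B) = {}" using IB(2) by blast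
    have csplit: "card (h ` g ` S \<inter> g ` S) = card (h ` I \<inter> I) + card (h ` B \<inter> B)"
      unfolding split using dj fin by (simp add: card_Un_disjoint)
    \<comment> \<open>An h from \<open>moves\<close> makes h(g(S)) meet g(S) in more points than
      g(S) meets S, without the two being equal.\<close>
    have "card I < card (h ` g ` S \<inter> g ` S) \<and> h ` g ` S \<noteq> g ` S"
      using hh
    proof
      assume c: "h ` A \<noteq> A \<and> h ` A \<inter> A \<noteq> {} \<and> h ` B = B"
      \<comment> \<open>Inclusion-exclusion inside S: h(I) and I share more than 2 card I - card S
        points, and h(B) = B adds card B = card S - card I.\<close>
      have "h ` I \<union> I = S - (h ` A \<inter> A)" using hI IA by blast
      moreover have "h ` A \<inter> A \<subseteq> S" using IA by blast
      moreover obtain z where "z \<in> h ` A \<inter> A" using c by blast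
      ultimately have "h ` I \<union> I \<subset> S" by blast
      then have "card (h ` I \<union> I) < card S"
        using fS by (rule psubset_card_mono[rotated])
      moreover have "card (h ` I) + card I = card (h ` I \<union> I) + card (h ` I \<inter> I)"
        using card_Un_Int[of "h ` I" I] fin(1) by simp
      moreover have "card (h ` I) = card I" using card_image_G h by blast
      ultimately have "2 * card I < card S + card (h ` I \<inter> I)" by linarith
      then have "card I < card (h ` g ` S \<inter> g ` S)"
        using csplit c cB by simp
      moreover have "h ` g ` S \<noteq> g ` S"
      proof
        assume "h ` g ` S = g ` S"
        then have "h ` I \<union> h ` B = I \<union> B" using IB(1) by (simp add: image_Un)
        then have "h ` I \<subseteq> I" using hIB(1) by blast
        then have "h ` I = I" using fin(1) ih by (simp add: endo_inj_surj inj_on_subset)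
        moreover have "S - A = I" using IA by blast
        ultimately have "S - h ` A = S - A" using hI by metis
        moreover have "h ` A \<subseteq> S" "A \<subseteq> S" using h(2) IA by auto
        ultimately have "h ` A = A" by (metis double_diff subset_refl)
        then show False using c by simp
      qed
      ultimately show ?thesis by blast
    next
      assume c: "h ` A = A \<and> h ` B \<noteq> B \<and> h ` B \<inter> B \<noteq> {}"
      have "S - A = I" using IA by blast
      then have "h ` I = I" using hI c by metis
      moreover have "card (h ` B \<inter> B) > 0" using c fin by (simp add: card_gt_0_iff)
      ultimately have "card I < card (h ` g ` S \<inter> g ` S)" using csplit by simp
      moreover have "h ` g ` S \<noteq> g ` S"
      proof
        assume "h ` g ` S = g ` S"
        then have "h ` I \<union> h ` B = I \<union> B" using IB(1) by (simp add: image_Un)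
        then have "h ` B \<subseteq> B" using hIB(2) by blast
        then have "h ` B = B" using fin(3) ih by (simp add: endo_inj_surj inj_on_subset)
        then show False using c by blast
      qed
      ultimately show ?thesis by blast
    qed
    \<comment> \<open>Conjugation by g brings the situation back to S: k(S) meets S in as many
      points as h(g(S)) meets g(S), against the choice of g.\<close>
    moreover define k where "k = inv' g \<circ> h \<circ> g"
    have kG: "k \<in> G" unfolding k_def using gG h by blast
    have "k ` S = inv' g ` h ` g ` S" unfolding k_def by (simp only: image_comp comp_assoc)
    then have gk: "g ` k ` S = h ` g ` S" using image_inv_G[OF gG] by simp
    have "g ` (k ` S \<inter> S) = h ` g ` S \<inter> g ` S"
      using gk image_Int[OF inj_G[OF gG]] by metis
    then have "card (k ` S \<inter> S) = card (h ` g ` S \<inter> g ` S)"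
      using card_image_G[OF gG] by metis
    moreover have "k ` S \<noteq> S" if "h ` g ` S \<noteq> g ` S" using that gk by metis
    ultimately have "k ` S \<noteq> S" "card I < card (k ` S \<inter> S)" by metis+
    moreover from this(2) have "k ` S \<inter> S \<noteq> {}" by force
    ultimately have "P k" unfolding P_def using kG by blast
    with \<open>card I < card (k ` S \<inter> S)\<close> show False using gmax unfolding I_def by (meson not_le)
  qed
  then obtain a where a: "A = {a}" using card_1_singletonE by blast
  obtain b where b: "B = {b}" using \<open>card A = 1\<close> ceq card_1_singletonE by metis
  have "I = S - {a}" using IA a by blast
  then have "g ` S = insert b (S - {a})" using IB(1) b by simp
  moreover have "a \<in> S" "b \<in> W - S" using a b IA BW by auto
  ultimately show ?thesis using that gG by blast
qed

text \<open>Call a set full if it has more than k points and all its k-subsets lie in F. The two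
  sets T0 and \<open>insert b0 (T0 - {a0})\<close> make \<open>insert b0 T0\<close> full, and by
  \<open>exchange\<close> a full set other than W can be enlarged by a point. F is a parameter
  because it is used both for the Jordan sets of a given size and for the supports of
  three-cycles.\<close>

lemma homogeneous:
  assumes prim: "primitive" and k: "2 \<le> k"
    and FJ: "\<And>T. T \<in> F \<Longrightarrow> jordan T \<and> card T = k"
    and FG: "\<And>T g. T \<in> F \<Longrightarrow> g \<in> G \<Longrightarrow> g ` T \<in> F"
    and T0: "T0 \<in> F" "a0 \<in> T0" "b0 \<in> W - T0" "insert b0 (T0 - {a0}) \<in> F"
    and T: "T \<subseteq> W" "card T = k"
  shows "T \<in> F"
proof -
  \<comment> \<open>The strict bound \<open>k < card S\<close> leaves a k-subset available after one
    point of S is removed.\<close>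
  define full where "full S \<longleftrightarrow> S \<subseteq> W \<and> k < card S \<and> (\<forall>T\<subseteq>S. card T = k \<longrightarrow> T \<in> F)" for S
  have fullG: "full (g ` S)" if "full S" "g \<in> G" for g S
    unfolding full_def
  proof (intro conjI allI impI)
    show "g ` S \<subseteq> W" "k < card (g ` S)"
      using that image_subset_W card_image_G unfolding full_def by auto
    fix T assume "T \<subseteq> g ` S" "card T = k"
    then have "inv' g ` T \<subseteq> S" "card (inv' g ` T) = k"
      using inv_image_G[OF that(2)] card_image_G[OF inv_G[OF that(2)]] by (metis image_mono, metis)
    then have "inv' g ` T \<in> F" using that unfolding full_def by blast
    then show "T \<in> F" using FG[OF _ that(2)] image_inv_G[OF that(2)] by metis
  qed
  have subF: "S \<subseteq> W" if "S \<in> F" for S using FJ that unfolding jordan_def by blast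
  have full0: "full (insert b0 T0)"
    unfolding full_def
  proof (intro conjI allI impI)
    have f0: "finite T0" using subF T0 finite_subset finite_W by blast
    show "insert b0 T0 \<subseteq> W" using subF T0 by blast
    show "k < card (insert b0 T0)" using FJ[OF T0(1)] T0 f0 by simp
    fix S assume S: "S \<subseteq> insert b0 T0" "card S = k"
    show "S \<in> F"
    proof (cases "S = T0")
      case False
      have fS: "finite S" using S f0 by (meson finite.insertI finite_subset)
      have "\<not> T0 \<subseteq> S" using False S FJ[OF T0(1)] fS by (metis card_subset_eq)
      then obtain c where c: "c \<in> T0" "c \<notin> S" by blast
      \<comment> \<open>Moving a0 to c within T0 turns the second given set into the k-subset that
        misses c.\<close>
      obtain h where h: "h \<in> G" "h a0 = c" "\<And>z. z \<notin> T0 \<Longrightarrow> h z = z" "h permutes T0"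
        using jordanD[of T0 a0 c] FJ T0 c by blast
      have "h ` insert b0 (T0 - {a0}) = insert b0 (T0 - {c})"
        using h T0 permutes_image[OF h(4)] inj_G[OF h(1)] by (simp add: image_set_diff)
      moreover have "S \<subseteq> insert b0 (T0 - {c})" using S c by blast
      moreover have "card (insert b0 (T0 - {c})) = k"
        using FJ[OF T0(1)] T0 c f0 k by simp
      ultimately show ?thesis
        using FG[OF T0(4) h(1)] S f0 by (metis card_subset_eq finite_Diff finite_insert)
    qed (use T0 in simp)
  qed
  have "card S \<le> card W" if "full S" for S
    using that unfolding full_def by (simp add: card_mono)
  then obtain S where S: "full S" and Smax: "\<And>S'. full S' \<Longrightarrow> card S' \<le> card S"
    using full0 ex_has_greatest_nat[of full _ card "Suc (card W)"] by (metis less_Suc_eq_le)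
  have fS: "finite S" using S finite_subset finite_W unfolding full_def by blast
  have SW: "S \<subseteq> W" and kS: "k < card S" using S unfolding full_def by auto
  \<comment> \<open>Two points of S - {w} lie in a common k-subset of S - {w}, which is a Jordan
    set. So even with w fixed, any point of S - {w} can be moved to any other.\<close>
  have two_trans: "\<exists>h\<in>G. h permutes S \<and> h x = y \<and> (\<forall>z. z \<notin> S - {w} \<longrightarrow> h z = z)"
    if "x \<in> S" "y \<in> S" "w \<in> S" "x \<noteq> w" "y \<noteq> w" for x y w
  proof -
    have "\<exists>R. {x, y} \<subseteq> R \<and> R \<subseteq> S - {w} \<and> card R = k"
    proof (rule exists_subset_between)
      have "card {x, y} \<le> 2" by (simp add: card_insert_if)
      then show "card {x, y} \<le> k" using k by simp
      show "k \<le> card (S - {w})" using kS fS that by simp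
    qed (use that fS in auto)
    then obtain R where R: "x \<in> R" "y \<in> R" "R \<subseteq> S - {w}" "card R = k" by blast
    then have "R \<in> F" using S unfolding full_def by blast
    then obtain h where h: "h \<in> G" "h x = y" "\<And>z. z \<notin> R \<Longrightarrow> h z = z" "h permutes R"
      using jordanD[of R x y] FJ R by metis
    then show ?thesis using R by (metis (no_types, lifting) Diff_subset permutes_subset subset_eq)
  qed
  have "S = W"
  proof (rule ccontr)
    assume "S \<noteq> W"
    obtain g a b where g: "g \<in> G" "a \<in> S" "b \<in> W - S" "g ` S = insert b (S - {a})"
    proof (rule exchange[OF prim SW _ \<open>S \<noteq> W\<close>])
      show "2 \<le> card S" using k kS by simp
      fix A B assume A: "A \<subset> S" "B \<subseteq> W - S" "card A = card B" "2 \<le> card A"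
      obtain c where c: "c \<in> S" "c \<notin> A" using A(1) by blast
      obtain x y where xy: "x \<in> A" "y \<in> A" "x \<noteq> y"
        using A(4) by (metis card_le_Suc0_iff_eq card.infinite not_numeral_le_zero not_less_eq_eq numeral_2_eq_2)
      \<comment> \<open>The element h keeps x in A and throws y out of A, so h(A) meets A without
        equalling it, while B is fixed pointwise.\<close>
      have "y \<in> S" "x \<in> S" "c \<noteq> x" using xy c A by auto
      then obtain h where h: "h \<in> G" "h permutes S" "h y = c" "\<And>z. z \<notin> S - {x} \<Longrightarrow> h z = z"
        using two_trans[of y c x] c xy by metis
      have "h ` S = S" using h(2) permutes_image by blast
      moreover have "h ` B = id ` B" using h(4) A(2) by (intro image_cong) auto
      moreover have "h x = x" using h(4) by simp
      then have "h ` A \<inter> A \<noteq> {}" using xy by (metis IntI empty_iff imageI)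
      moreover have "h ` A \<noteq> A" using xy h(3) c by blast
      ultimately show "\<exists>h\<in>G. h ` S = S \<and> (h ` A \<noteq> A \<and> h ` A \<inter> A \<noteq> {} \<and> h ` B = B \<or>
                           h ` A = A \<and> h ` B \<noteq> B \<and> h ` B \<inter> B \<noteq> {})"
        by (intro bexI[OF _ h(1)]) simp
    qed blast
    have "full (insert b S)"
      unfolding full_def
    proof (intro conjI allI impI)
      show "insert b S \<subseteq> W" using g SW by blast
      show "k < card (insert b S)" using kS fS g by simp
      fix R assume R: "R \<subseteq> insert b S" "card R = k"
      show "R \<in> F"
      proof (cases "b \<in> R")
        case False
        then show ?thesis using R S unfolding full_def by blast
      next
        case True
        \<comment> \<open>A k-set R containing b misses some c in S. Moving a to c within S carries
          the full set g(S) to S with c replaced by b, which contains R.\<close>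
        have "\<not> S \<subseteq> R"
          using kS R fS by (metis card_mono finite.insertI finite_subset not_le)
        then obtain c where c: "c \<in> S" "c \<notin> R" by blast
        have "\<exists>h\<in>G. h permutes S \<and> h a = c"
        proof -
          have "\<not> S \<subseteq> {a, c}"
          proof
            assume "S \<subseteq> {a, c}"
            then have "card S \<le> card {a, c}" by (intro card_mono) auto
            also have "\<dots> \<le> 2" by (simp add: card_insert_if)
            finally show False using k kS by simp
          qed
          then obtain w where "w \<in> S" "w \<noteq> a" "w \<noteq> c" by blast
          then show ?thesis using two_trans[of a c w] g c by blast
        qed
        then obtain h where h: "h \<in> G" "h permutes S" "h a = c" by blast
        have "h b = b" using h(2) g(3) by (simp add: permutes_not_in)
        then have "h ` g ` S = insert b (S - {c})"
          using g h permutes_image[OF h(2)] inj_G[OF h(1)] by (simp add: image_set_diff)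
        moreover have "full (h ` g ` S)" using fullG S g h by blast
        moreover have "R \<subseteq> insert b (S - {c})" using R c by blast
        ultimately show ?thesis using R(2) unfolding full_def by metis
      qed
    qed
    then show False using Smax[of "insert b S"] fS g by simp
  qed
  then show ?thesis using S T unfolding full_def by blast
qed

end

section \<open>Three-cycles\<close>

lemma cycle_funpow_nth:
  assumes "distinct cs" "i < length cs"
  shows "(cycle_of_list cs ^^ n) (cs ! i) = cs ! ((n + i) mod length cs)"
  using cyclic_rotation[OF assms(1), of n] assms(2) nth_map nth_rotate by (metis)

lemma three_cycle_apply:
  assumes "distinct [x, y, z]"
  shows "cycle_of_list [x, y, z] w = (if w = x then y else if w = y then z else if w = z then x else w)"
  using assms by (auto simp: transpose_def)

text \<open>Cycles stay folded, so that \<open>three_cycle_apply\<close> evaluates them instead of a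
  product of transpositions.\<close>

declare cycle_of_list.simps(1) [simp del]

lemma three_cycle_rotate:
  assumes "distinct [x, y, z]"
  shows "cycle_of_list [y, z, x] = cycle_of_list [x, y, z]"
proof
  fix w
  have "distinct [y, z, x]" using assms by auto
  then show "cycle_of_list [y, z, x] w = cycle_of_list [x, y, z] w"
    using assms by (simp only: three_cycle_apply) auto
qed

lemma three_cycle_square:
  assumes "distinct [x, y, z]"
  shows "cycle_of_list [x, y, z] \<circ> cycle_of_list [x, y, z] = cycle_of_list [x, z, y]"
proof
  fix w
  have "distinct [x, z, y]" using assms by auto
  then show "(cycle_of_list [x, y, z] \<circ> cycle_of_list [x, y, z]) w = cycle_of_list [x, z, y] w"
    using assms by (simp only: three_cycle_apply o_apply) auto
qed

context perm_group
begin

lemma jordan_cycle: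
  assumes "distinct cs" "set cs \<subseteq> W" "cycle_of_list cs \<in> G"
  shows "jordan (set cs)"
  unfolding jordan_def
proof (intro conjI ballI assms(2))
  fix x y assume "x \<in> set cs" "y \<in> set cs"
  then obtain i j where ij: "i < length cs" "j < length cs" "x = cs ! i" "y = cs ! j"
    by (metis in_set_conv_nth)
  \<comment> \<open>A rotation by j - i positions; adding the length keeps the exponent
    nonnegative.\<close>
  let ?h = "cycle_of_list cs ^^ (j + length cs - i)"
  have "?h x = y"
    using ij by (simp add: cycle_funpow_nth[OF assms(1)])
  moreover have "(cycle_of_list cs ^^ m) z = z" if "z \<notin> set cs" for m z
    using that by (induction m) (auto simp: id_outside_supp)
  ultimately show "\<exists>h\<in>G. h x = y \<and> (\<forall>z. z \<notin> set cs \<longrightarrow> h z = z)"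
    using funpow_G[OF assms(3)] by blast
qed

section \<open>From a Jordan set to all three-cycles\<close>

text \<open>If \<open>exchange\<close> were not applicable to some A and B, then A would behave like
  a block under the elements supported on T, so \<open>card A\<close> would divide
  \<open>card T\<close>. This is impossible for prime \<open>card T\<close>. In the other case B
  behaves in the same way in the complement, and \<open>card A\<close> = \<open>card B\<close> would
  divide two coprime numbers.\<close>

lemma exchange_jordan:
  assumes prim: "primitive" and T: "jordan T" "2 \<le> card T" "T \<noteq> W"
    and arith: "prime (card T) \<or> jordan (W - T) \<and> coprime (card T) (card (W - T))"
  obtains g a b where "g \<in> G" "a \<in> T" "b \<in> W - T" "g ` T = insert b (T - {a})"
proof (rule exchange[OF prim _ T(2,3)])
  show TW: "T \<subseteq> W" using T unfolding jordan_def by blast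
  then have fT: "finite T" using finite_W finite_subset by blast
  fix A B assume AB: "A \<subset> T" "B \<subseteq> W - T" "card A = card B" "2 \<le> card A"
  show "\<exists>h\<in>G. h ` T = T \<and> (h ` A \<noteq> A \<and> h ` A \<inter> A \<noteq> {} \<and> h ` B = B \<or>
                            h ` A = A \<and> h ` B \<noteq> B \<and> h ` B \<inter> B \<noteq> {})"
  proof (rule ccontr)
    assume no: "\<not> ?thesis"
    have fixB: "h ` D = D" if "h permutes R" "D \<inter> R = {}" for h :: "'a \<Rightarrow> 'a" and D R
    proof -
      have "z \<notin> R" if "z \<in> D" for z using that \<open>D \<inter> R = {}\<close> by blast
      then have "h ` D = id ` D" using permutes_not_in[OF that(1)] by (intro image_cong) auto
      then show ?thesis by simp
    qed
    have dA: "card A dvd card T"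
    proof (rule card_block_dvd[OF T(1)])
      show "A \<subseteq> T" "A \<noteq> {}" using AB by auto
      fix h assume h: "h \<in> G" "h permutes T"
      have "h ` T = T" using h(2) by (rule permutes_image)
      moreover have "h ` B = B" using AB(2) by (intro fixB[OF h(2)]) blast
      ultimately show "h ` A = A \<or> h ` A \<inter> A = {}" using no h(1) by metis
    qed
    have lt: "card A < card T" using AB(1) fT psubset_card_mono by blast
    from arith show False
    proof
      assume "prime (card T)"
      then show False using dA lt AB(4) by (auto simp: prime_nat_iff)
    next
      assume c: "jordan (W - T) \<and> coprime (card T) (card (W - T))"
      have "card B dvd card (W - T)"
      proof (rule card_block_dvd)
        show "jordan (W - T)" using c by blast
        show "B \<subseteq> W - T" "B \<noteq> {}" using AB by auto
        fix h assume h: "h \<in> G" "h permutes W - T"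
        have "h ` T = T" by (intro fixB[OF h(2)]) blast
        moreover have "h ` A = A" using AB(1) by (intro fixB[OF h(2)]) blast
        ultimately show "h ` B = B \<or> h ` B \<inter> B = {}" using no h(1) by metis
      qed
      then have "card A dvd 1" using dA c AB(3) by (metis coprime_common_divisor_nat dvd_1_iff_1 One_nat_def)
      then show False using AB(4) by simp
    qed
  qed
qed blast

text \<open>The commutator \<open>h \<circ> k \<circ> inv' h \<circ> inv' k\<close> sends c to h c,
  h c to k c and k c to c. At every other point the action of h or of k cancels, because c, the only
  common point of S and T, is not met on the way.\<close>

lemma commutator_three_cycle:
  assumes h: "h \<in> G" "h permutes S" and k: "k \<in> G" "k permutes T"
    and ST: "S \<inter> T = {c}" and c: "h c \<noteq> c" "k c \<noteq> c"
  shows "distinct [c, h c, k c]" "cycle_of_list [c, h c, k c] \<in> G"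
proof -
  have cST: "c \<in> S" "c \<in> T" using ST by auto
  have a: "h c \<in> S" "h c \<notin> T" using cST c ST permutes_in_image[OF h(2)] by blast+
  have b: "k c \<in> T" "k c \<notin> S" using cST c ST permutes_in_image[OF k(2)] by blast+
  show d: "distinct [c, h c, k c]" using a b c by auto
  let ?h' = "inv' h" and ?k' = "inv' k"
  have h': "?h' permutes S" and k': "?k' permutes T" using h k permutes_inv by auto
  have fixh: "h z = z" "?h' z = z" if "z \<notin> S" for z
    using that h(2) h' by (auto simp: permutes_not_in)
  have fixk: "k z = z" "?k' z = z" if "z \<notin> T" for z
    using that k(2) k' by (auto simp: permutes_not_in)
  have ih: "?h' (h z) = z" "h (?h' z) = z" for z using permutes_inverses[OF h(2)] by auto
  have ik: "?k' (k z) = z" "k (?k' z) = z" for z using permutes_inverses[OF k(2)] by auto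
  have "h \<circ> k \<circ> ?h' \<circ> ?k' = cycle_of_list [c, h c, k c]"
  proof
    fix z
    consider "z = c" | "z = h c" | "z = k c" | "z \<notin> {c, h c, k c}" by blast
    then show "(h \<circ> k \<circ> ?h' \<circ> ?k') z = cycle_of_list [c, h c, k c] z"
    proof cases
      case 1
      have "?k' c \<in> T" using cST permutes_in_image[OF k'] by blast
      moreover have "?k' c \<noteq> c" using c ik by metis
      ultimately have "?k' c \<notin> S" using ST by blast
      then show ?thesis using 1 fixh ik three_cycle_apply[OF d] by simp
    next
      case 2
      then show ?thesis using a b c fixh fixk ih three_cycle_apply[OF d] d by simp
    next
      case 3
      have "?h' c \<in> S" using cST permutes_in_image[OF h'] by blast
      moreover have "?h' c \<noteq> c" using c ih by metis
      ultimately have "?h' c \<notin> T" using ST by blast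
      then show ?thesis using 3 fixk ih ik three_cycle_apply[OF d] d by auto
    next
      case 4
      then have R: "cycle_of_list [c, h c, k c] z = z" using three_cycle_apply[OF d] by simp
      show ?thesis
      proof (cases "z \<in> T")
        case True
        have "?k' z \<in> T" using True permutes_in_image[OF k'] by blast
        moreover have "?k' z \<noteq> c" using 4 ik by (metis insertCI)
        ultimately have "?k' z \<notin> S" using ST by blast
        moreover have "z \<notin> S" using True 4 ST by blast
        ultimately show ?thesis using R fixh ik by simp
      next
        case False
        have "?h' z \<notin> T"
        proof (cases "z \<in> S")
          case True
          then have "?h' z \<in> S" using permutes_in_image[OF h'] by blast
          moreover have "?h' z \<noteq> c" using 4 ih by (metis insertCI)
          ultimately show ?thesis using ST by blast
        qed (use fixh False in simp)
        then show ?thesis using R False fixk ih by simp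
      qed
    qed
  qed
  then show "cycle_of_list [c, h c, k c] \<in> G"
    using h(1) k(1) by (metis comp_G inv_G)
qed

text \<open>By \<open>exchange_jordan\<close> and \<open>homogeneous\<close> every set of size
  \<open>card T\<close> is a Jordan set. One that meets T in a single point c, and elements moving c
  within either set, give the three-cycle as a commutator.\<close>

lemma three_cycle_exists:
  assumes prim: "primitive" and T: "jordan T" "2 \<le> card T" "2 * card T \<le> card W + 1" "T \<noteq> W"
    and arith: "prime (card T) \<or> jordan (W - T) \<and> coprime (card T) (card (W - T))"
  obtains x y z where "distinct [x, y, z]" "{x, y, z} \<subseteq> W" "cycle_of_list [x, y, z] \<in> G"
proof -
  define F where "F = {S. jordan S \<and> card S = card T}"
  have TW: "T \<subseteq> W" using T unfolding jordan_def by blast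
  then have fT: "finite T" using finite_W finite_subset by blast
  obtain g a b where g: "g \<in> G" "a \<in> T" "b \<in> W - T" "g ` T = insert b (T - {a})"
    using exchange_jordan[OF prim T(1,2,4) arith] by blast
  have F: "S \<in> F" if "S \<subseteq> W" "card S = card T" for S
  proof (rule homogeneous[OF prim T(2), of F T a b S])
    show "jordan R \<and> card R = card T" if "R \<in> F" for R using that unfolding F_def by blast
    show "h ` R \<in> F" if "R \<in> F" "h \<in> G" for R h
      using that jordan_image card_image_G unfolding F_def by auto
    show "T \<in> F" using T unfolding F_def by blast
    show "insert b (T - {a}) \<in> F"
      using jordan_image[OF T(1) g(1)] card_image_G[OF g(1), of T] g(4) unfolding F_def by simp
  qed (use g that in auto)
  obtain c where c: "c \<in> T" using T(2) by fastforce
  have "card (W - T) = card W - card T" using TW fT by (simp add: card_Diff_subset)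
  \<comment> \<open>The bound on \<open>card T\<close> leaves room outside T for all but one point
    of the second set.\<close>
  then have "card T - 1 \<le> card (W - T)" using T(3) by linarith
  then obtain R where R: "R \<subseteq> W - T" "card R = card T - 1" "finite R"
    using obtain_subset_with_card_n by metis
  have "insert c R \<in> F"
    using R c TW T(2) by (intro F) (auto simp: card_insert_if)
  then have J: "jordan (insert c R)" unfolding F_def by blast
  obtain u where u: "u \<in> T" "u \<noteq> c"
    using T(2) fT c by (metis card_1_singleton_iff insertI1 insert_absorb not_numeral_le_zero numeral_le_one_iff One_nat_def is_singletonI' is_singleton_altdef semiring_norm(69) empty_iff)
  have "R \<noteq> {}" using R(2) T(2) by auto
  then obtain v where v: "v \<in> R" by blast
  then have vc: "v \<noteq> c" using R c by blast
  obtain h where h: "h \<in> G" "h c = u" "h permutes T" using jordanD[OF T(1) c u(1)] by metis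
  obtain k where k: "k \<in> G" "k c = v" "k permutes insert c R" using jordanD[OF J, of c v] v by blast
  have TR: "T \<inter> insert c R = {c}" using c R by blast
  note * = commutator_three_cycle[OF h(1,3) k(1,3) TR, unfolded h(2) k(2), OF u(2) vc]
  moreover have "{c, u, v} \<subseteq> W" using c u v R TW by blast
  ultimately show ?thesis using that by blast
qed

text \<open>The supports of three-cycles in G are Jordan sets of prime size 3, and conjugation by G
  permutes them, so by \<open>homogeneous\<close> every triple of points is such a support. A
  three-cycle and its square give all orderings of the triple.\<close>

lemma all_three_cycles:
  assumes prim: "primitive" and n: "4 \<le> card W"
    and xyz: "distinct [x, y, z]" "{x, y, z} \<subseteq> W" "cycle_of_list [x, y, z] \<in> G"
    and uvw: "distinct [u, v, w]" "{u, v, w} \<subseteq> W"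
  shows "cycle_of_list [u, v, w] \<in> G"
proof -
  define F where "F = {{x, y, z} |x y z. distinct [x, y, z] \<and> {x, y, z} \<subseteq> W \<and> cycle_of_list [x, y, z] \<in> G}"
  have FJ: "jordan R \<and> card R = 3" if RF: "R \<in> F" for R
  proof -
    obtain x y z where R: "R = {x, y, z}" "distinct [x, y, z]" "{x, y, z} \<subseteq> W" "cycle_of_list [x, y, z] \<in> G"
      using RF unfolding F_def by blast
    then show ?thesis using jordan_cycle[of "[x, y, z]"] by simp
  qed
  have FG: "h ` R \<in> F" if RF: "R \<in> F" "h \<in> G" for R h
  proof -
    obtain x y z where R: "R = {x, y, z}" "distinct [x, y, z]" "{x, y, z} \<subseteq> W" "cycle_of_list [x, y, z] \<in> G"
      using RF(1) unfolding F_def by blast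
    have "h \<circ> cycle_of_list [x, y, z] \<circ> inv' h \<in> G"
      using R(4) RF(2) by (intro comp_G inv_G)
    then have "cycle_of_list [h x, h y, h z] \<in> G"
      using conjugation_of_cycle[OF R(2) bij_G[OF RF(2)]] by simp
    moreover have "distinct [h x, h y, h z]" using R(2) inj_G[OF RF(2)] by (auto dest: injD)
    moreover have "{h x, h y, h z} \<subseteq> W" using image_subset_W[OF RF(2) R(3)] by simp
    ultimately show ?thesis unfolding F_def R(1) by auto
  qed
  have T: "{x, y, z} \<in> F" unfolding F_def using xyz by blast
  note JT = FJ[OF T]
  have "{x, y, z} \<noteq> W" using JT n by auto
  then obtain g a b where g: "g \<in> G" "a \<in> {x, y, z}" "b \<in> W - {x, y, z}" "g ` {x, y, z} = insert b ({x, y, z} - {a})"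
    using exchange_jordan[OF prim, of "{x, y, z}"] JT by auto
  have "{u, v, w} \<in> F"
  proof (rule homogeneous[OF prim, of 3 F "{x, y, z}" a b])
    show "insert b ({x, y, z} - {a}) \<in> F" using FG[OF T g(1)] g(4) by simp
    show "card {u, v, w} = 3" using uvw by simp
  qed (use FJ FG T g uvw in auto)
  then obtain p q r where pqr: "{u, v, w} = {p, q, r}" "distinct [p, q, r]" "cycle_of_list [p, q, r] \<in> G"
    unfolding F_def by blast
  have rot: "cycle_of_list [q, r, p] \<in> G" "cycle_of_list [r, p, q] \<in> G"
    using three_cycle_rotate[of p q r] three_cycle_rotate[of q r p] pqr(2,3) by auto
  \<comment> \<open>The square of a three-cycle is its inverse and supplies the opposite
    orientation.\<close>
  have sq: "cycle_of_list [p, r, q] \<in> G" "cycle_of_list [q, p, r] \<in> G" "cycle_of_list [r, q, p] \<in> G"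
  proof -
    have d: "distinct [q, r, p]" "distinct [r, p, q]" using pqr(2) by auto
    show "cycle_of_list [p, r, q] \<in> G" using comp_G[OF pqr(3,3)] three_cycle_square[OF pqr(2)] by simp
    show "cycle_of_list [q, p, r] \<in> G" using comp_G[OF rot(1,1)] three_cycle_square[OF d(1)] by simp
    show "cycle_of_list [r, q, p] \<in> G" using comp_G[OF rot(2,2)] three_cycle_square[OF d(2)] by simp
  qed
  have "u \<in> {p, q, r}" "v \<in> {p, q, r}" "w \<in> {p, q, r}" using pqr(1) by blast+
  then have "(u, v, w) \<in> {(p, q, r), (q, r, p), (r, p, q), (p, r, q), (q, p, r), (r, q, p)}"
    using uvw(1) by auto
  then show ?thesis using pqr(3) rot sq by auto
qed

end

section \<open>Permutations with at most three prescribed cycles\<close>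

lemma funpow_cong_on:
  assumes "\<And>y. y \<in> S \<Longrightarrow> f y = g y" "g ` S \<subseteq> S" "z \<in> S"
  shows "(f ^^ m) z = (g ^^ m) z" "(g ^^ m) z \<in> S"
proof (induction m)
  case (Suc m)
  { case 1 show ?case using Suc assms(1) by simp }
  { case 2 show ?case using Suc(2) assms(2) by auto }
qed (use assms(3) in auto)

lemma cycle_funpow_dvd:
  assumes "distinct cs" "cs = [] \<or> length cs dvd m" "z \<in> set cs"
  shows "(cycle_of_list cs ^^ m) z = z"
proof -
  obtain i where i: "i < length cs" "z = cs ! i" using assms(3) by (metis in_set_conv_nth)
  have "(m + i) mod length cs = i" using assms(2,3) i by (auto elim!: dvdE)
  then show ?thesis using cycle_funpow_nth[OF assms(1) i(1), of m] i by simp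
qed

lemma cycle_funpow_mod:
  assumes "distinct cs" "m mod length cs = 1 mod length cs" "z \<in> set cs"
  shows "(cycle_of_list cs ^^ m) z = cycle_of_list cs z"
proof -
  obtain i where i: "i < length cs" "z = cs ! i" using assms(3) by (metis in_set_conv_nth)
  have "(m + i) mod length cs = (1 + i) mod length cs" using assms(2) by (metis mod_add_left_eq)
  then show ?thesis
    using cycle_funpow_nth[OF assms(1) i(1), of m] cycle_funpow_nth[OF assms(1) i(1), of 1] i by simp
qed

lemma cycle_invariant:
  assumes "distinct cs" "cycle_of_list cs ` X \<subseteq> X" "set cs \<inter> X \<noteq> {}"
  shows "set cs \<subseteq> X"
proof
  fix y assume "y \<in> set cs"
  then obtain j where j: "j < length cs" "y = cs ! j" by (metis in_set_conv_nth)
  obtain i where i: "i < length cs" "cs ! i \<in> X" using assms(3) by (metis disjoint_iff in_set_conv_nth)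
  have "(cycle_of_list cs ^^ m) (cs ! i) \<in> X" for m
    using funpow_cong_on(2)[OF refl assms(2) i(2)] .
  moreover have "(cycle_of_list cs ^^ (j + length cs - i)) (cs ! i) = y"
    using i j by (simp add: cycle_funpow_nth[OF assms(1)])
  ultimately show "y \<in> X" by metis
qed

text \<open>A fixed point is a list of length 1 and an empty list is an absent cycle, so one
  predicate covers permutations of W with one, two or three cycles.\<close>

definition cycles3 :: "'a set \<Rightarrow> 'a list \<Rightarrow> 'a list \<Rightarrow> 'a list \<Rightarrow> ('a \<Rightarrow> 'a) \<Rightarrow> bool" where
  "cycles3 W us vs ws x \<longleftrightarrow> distinct (us @ vs @ ws) \<and> set (us @ vs @ ws) = W \<and>
     x = cycle_of_list us \<circ> cycle_of_list vs \<circ> cycle_of_list ws"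

lemma cycles3_apply:
  assumes "cycles3 W us vs ws x"
  shows "z \<in> set us \<Longrightarrow> x z = cycle_of_list us z"
    and "z \<in> set vs \<Longrightarrow> x z = cycle_of_list vs z"
    and "z \<in> set ws \<Longrightarrow> x z = cycle_of_list ws z"
    and "z \<notin> W \<Longrightarrow> x z = z"
proof -
  have d: "set us \<inter> set vs = {}" "set us \<inter> set ws = {}" "set vs \<inter> set ws = {}"
    and x: "x = cycle_of_list us \<circ> cycle_of_list vs \<circ> cycle_of_list ws"
    and W: "W = set us \<union> set vs \<union> set ws"
    using assms unfolding cycles3_def by auto
  note perm = permutes_in_image[OF cycle_permutes]
  show "x z = cycle_of_list us z" if "z \<in> set us"
    using that d unfolding x by (simp add: id_outside_supp disjoint_iff)
  show "x z = cycle_of_list vs z" if "z \<in> set vs"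
  proof -
    have "cycle_of_list vs z \<notin> set us" using perm[of vs z] that d by blast
    moreover have "z \<notin> set ws" using that d by blast
    ultimately show ?thesis unfolding x by (simp add: id_outside_supp)
  qed
  show "x z = cycle_of_list ws z" if "z \<in> set ws"
  proof -
    have "cycle_of_list ws z \<notin> set us" "cycle_of_list ws z \<notin> set vs" using perm[of ws z] that d by blast+
    then show ?thesis unfolding x by (simp add: id_outside_supp)
  qed
  show "x z = z" if "z \<notin> W"
    using that unfolding x W by (simp add: id_outside_supp)
qed

lemma cycles3_permutes:
  assumes "cycles3 W us vs ws x"
  shows "x permutes W"
proof -
  have "cycle_of_list cs permutes W" if "set cs \<subseteq> W" for cs
    using cycle_permutes that by (rule permutes_subset)
  then show ?thesis
    using assms unfolding cycles3_def by (auto intro!: permutes_compose)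
qed

text \<open>Relabelling entries keeps the lengths. Hence a member of a basic set that contains a
  conjugate of x contains an element with the cycle lengths of x.\<close>

lemma cycles3_conj:
  assumes x: "cycles3 W us vs ws x" and g: "g permutes W"
  shows "cycles3 W (map g us) (map g vs) (map g ws) (g \<circ> x \<circ> inv' g)"
proof -
  have b: "bij g" and i: "inj g" using g permutes_bij bij_is_inj by blast+
  have ii: "inv' g \<circ> g = id" using i by simp
  have d: "distinct us" "distinct vs" "distinct ws" using x unfolding cycles3_def by auto
  have "g \<circ> x \<circ> inv' g = (g \<circ> cycle_of_list us \<circ> inv' g) \<circ> (g \<circ> cycle_of_list vs \<circ> inv' g) \<circ> (g \<circ> cycle_of_list ws \<circ> inv' g)"
    using x i unfolding cycles3_def by (auto simp: fun_eq_iff)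
  moreover have "distinct (map g (us @ vs @ ws))"
    using x inj_on_subset[OF i subset_UNIV, of W] unfolding cycles3_def
    by (simp add: distinct_map del: map_append distinct_append)
  moreover have "set (map g (us @ vs @ ws)) = W"
    using x permutes_image[OF g] unfolding cycles3_def by (simp only: set_map)
  ultimately show ?thesis
    unfolding cycles3_def using conjugation_of_cycle[OF d(1) b] conjugation_of_cycle[OF d(2) b] conjugation_of_cycle[OF d(3) b]
    by (simp only: map_append simp_thms)
qed

lemma cycles3_invariant:
  assumes x: "cycles3 W us vs ws x" and X: "x ` X \<subseteq> X" and cs: "cs \<in> {us, vs, ws}"
  shows "set cs \<subseteq> X \<or> set cs \<inter> X = {}"
proof -
  have "distinct cs" using x cs unfolding cycles3_def by auto
  moreover have "cycle_of_list cs ` (X \<inter> set cs) \<subseteq> X \<inter> set cs"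
  proof
    fix y assume "y \<in> cycle_of_list cs ` (X \<inter> set cs)"
    then obtain z where z: "z \<in> X" "z \<in> set cs" "y = cycle_of_list cs z" by blast
    have "x z = y" using z cs cycles3_apply[OF x] by auto
    then have "y \<in> X" using X z(1) by auto
    moreover have "y \<in> set cs" using z(2,3) permutes_in_image[OF cycle_permutes, of cs z] by simp
    ultimately show "y \<in> X \<inter> set cs" by simp
  qed
  ultimately show ?thesis using cycle_invariant[of cs "X \<inter> set cs"] by blast
qed

lemma cycles3_card:
  assumes "cycles3 W us vs ws x"
  shows "card W = length us + length vs + length ws"
  using assms distinct_card[of "us @ vs @ ws"] unfolding cycles3_def by simp

text \<open>An invariant set is a union of cycles. The two cases are kept apart because a block will
  be known to contain the first cycle.\<close>

lemma cycles3_invariant_card: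
  assumes x: "cycles3 W us vs ws x" and X: "x ` X \<subseteq> X" "X \<subseteq> W"
  obtains "set us \<subseteq> X" "card X \<in> {length us, length us + length vs, length us + length ws, card W}"
  | "set us \<inter> X = {}" "card X \<in> {0, length vs, length ws, length vs + length ws}"
proof -
  have d: "distinct us" "distinct vs" "distinct ws" "set us \<inter> set vs = {}" "set us \<inter> set ws = {}" "set vs \<inter> set ws = {}"
    and W: "W = set us \<union> set vs \<union> set ws"
    using x unfolding cycles3_def by auto
  define U V Z where "U = X \<inter> set us" and "V = X \<inter> set vs" and "Z = X \<inter> set ws"
  have "X = U \<union> V \<union> Z" using X(2) W unfolding U_def V_def Z_def by blast
  moreover have "finite U" "finite V" "finite Z" "U \<inter> V = {}" "U \<inter> Z = {}" "V \<inter> Z = {}"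
    using d unfolding U_def V_def Z_def by auto
  ultimately have "card X = card U + card V + card Z"
    by (simp add: card_Un_disjoint Int_Un_distrib2)
  moreover have "set us \<subseteq> X \<and> card U = length us \<or> set us \<inter> X = {} \<and> card U = 0"
    using cycles3_invariant[OF x X(1), of us] distinct_card[OF d(1)] unfolding U_def by (auto simp: Int_absorb1 Int_commute)
  moreover have "card V = length vs \<or> card V = 0"
    using cycles3_invariant[OF x X(1), of vs] distinct_card[OF d(2)] unfolding V_def by (auto simp: Int_absorb1 Int_commute)
  moreover have "card Z = length ws \<or> card Z = 0"
    using cycles3_invariant[OF x X(1), of ws] distinct_card[OF d(3)] unfolding Z_def by (auto simp: Int_absorb1 Int_commute)
  ultimately show ?thesis using that cycles3_card[OF x] by auto
qed

context perm_group
begin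

text \<open>By Bezout some multiple of M is 1 modulo the length of us. The corresponding power of x
  acts on us as x does and trivially on the other two cycles, whose lengths divide M.\<close>

lemma cycle_in_group:
  assumes x: "cycles3 W us vs ws x" "x \<in> G"
    and M: "coprime (length us) M" "M \<noteq> 0" "vs = [] \<or> length vs dvd M" "ws = [] \<or> length ws dvd M"
  shows "cycle_of_list us \<in> G"
proof -
  obtain i j where "M * i = length us * j + gcd M (length us)" using bezout_nat[OF M(2)] by blast
  then have "M * i = length us * j + 1" using M(1) by (simp add: coprime_iff_gcd_eq_1 gcd.commute)
  then have m: "(M * i) mod length us = 1 mod length us" by (simp only: mod_mult_self4)
  have d: "distinct us" "distinct vs" "distinct ws" "set us \<inter> set vs = {}" "set us \<inter> set ws = {}"
    and W: "W = set us \<union> set vs \<union> set ws"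
    using x unfolding cycles3_def by auto
  note ap = cycles3_apply[OF x(1)]
  have im: "cycle_of_list cs ` set cs \<subseteq> set cs" for cs :: "'a list"
    using permutes_image[OF cycle_permutes, of cs] by simp
  have "x ^^ (M * i) = cycle_of_list us"
  proof
    fix z
    consider "z \<in> set us" | "z \<in> set vs" | "z \<in> set ws" | "z \<notin> W" using W by blast
    then show "(x ^^ (M * i)) z = cycle_of_list us z"
    proof cases
      case 1
      then show ?thesis using funpow_cong_on(1)[OF ap(1) im 1] cycle_funpow_mod[OF d(1) m 1] by simp
    next
      case 2
      then have "z \<notin> set us" using d by blast
      moreover have "vs = [] \<or> length vs dvd M * i" using M(3) by auto
      ultimately show ?thesis
        using funpow_cong_on(1)[OF ap(2) im 2, of "M * i"] cycle_funpow_dvd[OF d(2) _ 2, of "M * i"] by (simp add: id_outside_supp)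
    next
      case 3
      then have "z \<notin> set us" using d by blast
      moreover have "ws = [] \<or> length ws dvd M * i" using M(4) by auto
      ultimately show ?thesis
        using funpow_cong_on(1)[OF ap(3) im 3, of "M * i"] cycle_funpow_dvd[OF d(3) _ 3, of "M * i"] by (simp add: id_outside_supp)
    next
      case 4
      have "(x ^^ m) z = z" for m using ap(4)[OF 4] by (induction m) auto
      then show ?thesis using 4 W by (simp add: id_outside_supp)
    qed
  qed
  then show ?thesis using funpow_G[OF x(2)] by metis
qed

section \<open>Invariant sets and criteria for transitivity and primitivity\<close>

definition invariant :: "'a set \<Rightarrow> bool" where
  "invariant X \<longleftrightarrow> X \<subseteq> W \<and> (\<forall>g\<in>G. g ` X = X)"

text \<open>The orbit of a point is a nonempty invariant set.\<close>

lemma transitive_if_no_invariant: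
  assumes "\<And>X. invariant X \<Longrightarrow> X = {} \<or> X = W"
  shows "jordan W"
  unfolding jordan_def
proof (intro conjI ballI subset_refl)
  fix x y assume xy: "x \<in> W" "y \<in> W"
  define X where "X = (\<lambda>g. g x) ` G"
  have sub: "g ` X \<subseteq> X" if "g \<in> G" for g
    unfolding X_def using that by (auto intro!: image_eqI[of _ _ "g \<circ> _"])
  have "g ` X = X" if "g \<in> G" for g
  proof (rule subset_antisym[OF sub[OF that]])
    have "g ` (inv' g ` X) \<subseteq> g ` X" using sub[OF inv_G[OF that]] by (rule image_mono)
    then show "X \<subseteq> g ` X" using image_inv_G[OF that] by simp
  qed
  moreover have "X \<subseteq> W" using xy unfolding X_def by (auto simp: permutes_in_image[OF permutes_W])
  ultimately have "invariant X" unfolding invariant_def by blast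
  moreover have "x \<in> X" unfolding X_def by (rule image_eqI[of _ _ id]) auto
  ultimately have "y \<in> X" using assms xy by blast
  then obtain h where "h \<in> G" "h x = y" unfolding X_def by blast
  then show "\<exists>h\<in>G. h x = y \<and> (\<forall>z. z \<notin> W \<longrightarrow> h z = z)"
    using permutes_W permutes_not_in by metis
qed

lemma block_image:
  assumes "block A" "g \<in> G"
  shows "block (g ` A)"
  unfolding block_def
proof
  fix h assume "h \<in> G"
  then have "inv' g \<circ> h \<circ> g \<in> G" using assms(2) by blast
  with assms(1)[unfolded block_def]
  have "(inv' g \<circ> h \<circ> g) ` A = A \<or> (inv' g \<circ> h \<circ> g) ` A \<inter> A = {}" by (rule bspec)
  then have *: "inv' g ` h ` g ` A = A \<or> inv' g ` h ` g ` A \<inter> A = {}"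
    by (simp only: image_comp comp_assoc)
  have **: "g ` inv' g ` h ` g ` A = h ` g ` A" by (rule image_inv_G[OF assms(2)])
  from * show "h ` g ` A = g ` A \<or> h ` g ` A \<inter> g ` A = {}"
  proof
    assume "inv' g ` h ` g ` A = A"
    then show ?thesis using ** by simp
  next
    assume "inv' g ` h ` g ` A \<inter> A = {}"
    then have "g ` (inv' g ` h ` g ` A \<inter> A) = {}" by simp
    then have "g ` inv' g ` h ` g ` A \<inter> g ` A = {}"
      using image_Int[OF inj_G[OF assms(2)]] by metis
    then show ?thesis using ** by simp
  qed
qed

lemma block_eq: "block A \<Longrightarrow> g \<in> G \<Longrightarrow> z \<in> A \<Longrightarrow> g z \<in> A \<Longrightarrow> g ` A = A"
  unfolding block_def by blast

lemma block_card_dvd: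
  assumes "jordan W" "block A" "A \<subseteq> W" "A \<noteq> {}"
  shows "card A dvd card W"
  using card_block_dvd[OF assms(1,3,4)] assms(2) unfolding block_def by blast

lemma primitive_prime_degree:
  assumes "jordan W" "prime (card W)"
  shows "primitive"
  unfolding primitive_def
proof (intro allI impI, elim conjE)
  fix A assume A: "A \<subseteq> W" "block A" "2 \<le> card A"
  then have "card A dvd card W" using block_card_dvd[OF assms(1) A(2,1)] by fastforce
  then have "card A = card W" using assms(2) A(3) by (auto simp: prime_nat_iff)
  then show "A = W" using A(1) card_subset_eq by blast
qed

text \<open>Move a block to D, containing a point of the p-cycle us. If D lies inside us, its size
  divides p, so it is p, which does not divide n. Otherwise us fixes a point of D, hence preserves
  D, and D contains us. Then x preserves D too, so D is a union of cycles of x including us, and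
  \<open>vs\<close>, \<open>ws\<close> exclude all such sizes below n that divide n.\<close>

lemma primitive_long_cycle:
  assumes J: "jordan W" and x: "cycles3 W us vs ws x" "x \<in> G"
    and c: "cycle_of_list us \<in> G" and p: "prime (length us)" "\<not> length us dvd card W"
    and vs: "length us + length vs dvd card W \<Longrightarrow> ws = []"
    and ws: "length us + length ws dvd card W \<Longrightarrow> ws = []"
  shows "primitive"
  unfolding primitive_def
proof (intro allI impI, elim conjE)
  fix A assume A: "A \<subseteq> W" "block A" "2 \<le> card A"
  show "A = W"
  proof (rule ccontr)
    assume "A \<noteq> W"
    have cA: "card A dvd card W" using block_card_dvd[OF J A(2,1)] A(3) by fastforce
    have cA': "card A \<noteq> card W" using \<open>A \<noteq> W\<close> A(1) card_subset_eq by blast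
    have us: "distinct us" "set us \<subseteq> W" using x unfolding cycles3_def by auto
    have cus: "card (set us) = length us" using us distinct_card by blast
    have JU: "jordan (set us)" by (rule jordan_cycle[OF us c])
    have "us \<noteq> []" using p(1) by auto
    then obtain u where u: "u \<in> set us" by (meson hd_in_set)
    obtain a where a: "a \<in> A" using A(3) by fastforce
    obtain g where g: "g \<in> G" "g a = u" using jordanD[OF J, of a u] a u A(1) us by blast
    define D where "D = g ` A"
    have D: "block D" "u \<in> D" "D \<subseteq> W" "card D = card A"
      unfolding D_def using block_image[OF A(2) g(1)] a g image_subset_W[OF g(1) A(1)] card_image_G[OF g(1)] by auto
    show False
    proof (cases "D \<subseteq> set us")
      case True
      have "card D dvd length us"
        using card_block_dvd[OF JU True] D(1,2) cus unfolding block_def by (metis empty_iff)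
      then have "card D = length us" using p(1) D(4) A(3) by (auto simp: prime_nat_iff)
      then show False using cA D(4) p(2) by simp
    next
      case False
      then obtain v where v: "v \<in> D" "v \<notin> set us" by blast
      have "cycle_of_list us ` D = D"
        using block_eq[OF D(1) c v(1)] v by (simp add: id_outside_supp)
      then have UD: "set us \<subseteq> D" using cycle_invariant[OF us(1), of D] u D(2) by blast
      have "x u \<in> set us"
        using cycles3_apply(1)[OF x(1) u] permutes_in_image[OF cycle_permutes, of us u] u by simp
      then have "x ` D = D" using block_eq[OF D(1) x(2) D(2)] UD by blast
      then have xD: "x ` D \<subseteq> D" by simp
      show False
        by (rule cycles3_invariant_card[OF x(1) xD D(3)])
          (use cA cA' D(4) p(2) vs ws cycles3_card[OF x(1)] UD u in auto)
    qed
  qed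
qed

end

section \<open>Normal coverings\<close>

lemma (in group) conj_subgroup_iff:
  assumes "H \<subseteq> carrier G" "g \<in> carrier G"
  shows "x \<in> conj_subgroup G H g \<longleftrightarrow> (\<exists>h\<in>H. x = inv g \<otimes> h \<otimes> g)"
  using assms unfolding conj_subgroup_def l_coset_def r_coset_def
  by (auto simp: m_assoc subset_iff)

text \<open>Compared with a basic set, conjugate members are allowed, which makes coverings easy to
  write down; minimality restores non-conjugacy.\<close>

definition normal_cover :: "('a, 'b) monoid_scheme \<Rightarrow> 'a set set \<Rightarrow> bool" where
  "normal_cover G F \<longleftrightarrow> finite F \<and> (\<forall>H\<in>F. subgroup H G \<and> H \<noteq> carrier G) \<and>
     carrier G \<subseteq> (\<Union>H\<in>F. \<Union>g\<in>carrier G. conj_subgroup G H g)"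

text \<open>Take a smallest covering subfamily. If K were a conjugate of another member H, every
  conjugate of K would be a conjugate of H, and K could be dropped.\<close>

lemma (in group) basic_set_if_normal_cover:
  assumes "normal_cover G F"
  obtains B where "basic_set G B" "card B \<le> card F"
proof -
  define P where "P B \<longleftrightarrow> B \<subseteq> F \<and> normal_cover G B" for B
  obtain B where B: "P B" and Bmin: "\<And>C. P C \<Longrightarrow> card B \<le> card C"
    using ex_has_least_nat[of P F card] assms unfolding P_def by blast
  have fB: "finite B" using B unfolding P_def normal_cover_def by blast
  have sg: "subgroup H G" if "H \<in> B" for H
    using B that unfolding P_def normal_cover_def by simp
  have sub: "H \<subseteq> carrier G" if "H \<in> B" for H
    by (rule subgroup.subset[OF sg[OF that]])
  have cov: "carrier G \<subseteq> (\<Union>H\<in>B. \<Union>g\<in>carrier G. conj_subgroup G H g)"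
    using B unfolding P_def normal_cover_def by simp
  have incl: "conj_subgroup G H g \<subseteq> carrier G" if "H \<in> B" "g \<in> carrier G" for H g
    using conj_subgroup_iff[OF sub[OF that(1)] that(2)] sub[OF that(1)] that(2) by (auto simp: subset_iff)
  have ncj: "False" if HK: "H \<in> B" "K \<in> B" "H \<noteq> K" "g \<in> carrier G" "K = conj_subgroup G H g" for H K g
  proof -
    have "carrier G \<subseteq> (\<Union>H\<in>B - {K}. \<Union>g\<in>carrier G. conj_subgroup G H g)"
    proof
      fix x assume "x \<in> carrier G"
      then obtain L h where L: "L \<in> B" "h \<in> carrier G" "x \<in> conj_subgroup G L h"
        using cov by blast
      show "x \<in> (\<Union>H\<in>B - {K}. \<Union>g\<in>carrier G. conj_subgroup G H g)"
      proof (cases "L = K")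
        case False
        then show ?thesis using L by blast
      next
        case True
        obtain k where k: "k \<in> K" "x = inv h \<otimes> k \<otimes> h"
          using L(3) conj_subgroup_iff[OF sub[OF HK(2)] L(2)] True by blast
        obtain y where y: "y \<in> H" "k = inv g \<otimes> y \<otimes> g"
          using k(1) HK(5) conj_subgroup_iff[OF sub[OF HK(1)] HK(4)] by blast
        have "y \<in> carrier G" using y(1) sub[OF HK(1)] by blast
        then have "x = inv (g \<otimes> h) \<otimes> y \<otimes> (g \<otimes> h)"
          using k(2) y(2) L(2) HK(4) by (simp add: inv_mult_group m_assoc)
        then have "x \<in> conj_subgroup G H (g \<otimes> h)"
          using conj_subgroup_iff[OF sub[OF HK(1)], of "g \<otimes> h" x] y(1) L(2) HK(4) by auto
        moreover have "H \<in> B - {K}" "g \<otimes> h \<in> carrier G" using HK L(2) by auto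
        ultimately show ?thesis by blast
      qed
    qed
    then have "P (B - {K})"
      using B unfolding P_def normal_cover_def by auto
    then have "card B \<le> card (B - {K})" by (rule Bmin)
    then show False using HK(2) fB by (metis card_Diff1_less not_le)
  qed
  have "carrier G = (\<Union>H\<in>B. \<Union>g\<in>carrier G. conj_subgroup G H g)"
    using incl cov by (intro subset_antisym UN_least)
  then have "basic_set G B"
    unfolding basic_set_def using B ncj unfolding P_def normal_cover_def by metis
  moreover have "card B \<le> card F" by (rule Bmin) (use assms in \<open>auto simp: P_def\<close>)
  ultimately show ?thesis using that by blast
qed

lemma (in group) gamma_num_le:
  assumes "normal_cover G F"
  shows "gamma_num G \<le> card F"
proof -
  obtain B where "basic_set G B" "card B \<le> card F" using basic_set_if_normal_cover[OF assms] .
  then have "gamma_num G \<le> card B" unfolding gamma_num_def by (intro Least_le exI[of _ B]) simp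
  with \<open>card B \<le> card F\<close> show ?thesis by simp
qed

section \<open>Existence of a basic set in a finite non-abelian group\<close>

definition centralizer :: "('a, 'b) monoid_scheme \<Rightarrow> 'a \<Rightarrow> 'a set" where
  "centralizer G g = {h \<in> carrier G. h \<otimes>\<^bsub>G\<^esub> g = g \<otimes>\<^bsub>G\<^esub> h}"

lemma (in group) centralizer_subgroup:
  assumes "g \<in> carrier G"
  shows "subgroup (centralizer G g) G"
proof
  show "centralizer G g \<subseteq> carrier G" "\<one> \<in> centralizer G g"
    using assms unfolding centralizer_def by auto
  show "x \<otimes> y \<in> centralizer G g" if "x \<in> centralizer G g" "y \<in> centralizer G g" for x y
    using that assms unfolding centralizer_def by (auto simp: m_assoc) (metis m_assoc)
  show "inv x \<in> centralizer G g" if "x \<in> centralizer G g" for x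
    using that assms unfolding centralizer_def
    by auto (metis inv_closed inv_solve_left inv_solve_right m_assoc m_closed)
qed

lemma (in group) in_conj_subgroup_one:
  assumes "subgroup H G" "x \<in> H"
  shows "x \<in> conj_subgroup G H \<one>"
  using assms conj_subgroup_iff[OF subgroup.subset[OF assms(1)] one_closed]
  by (auto simp: subgroup.mem_carrier intro!: bexI[of _ x])

text \<open>The value of the \<open>LEAST\<close> means something only if a basic set exists. The
  proper centralizers cover the group: a non-central element lies in its own, and a central one in
  that of the non-central h.\<close>

lemma (in group) gamma_num_attained:
  assumes fin: "finite (carrier G)" and gh: "g \<in> carrier G" "h \<in> carrier G" "g \<otimes> h \<noteq> h \<otimes> g"
  obtains B where "basic_set G B" "card B = gamma_num G"
proof -
  define F where "F = {H. \<exists>g\<in>carrier G. H = centralizer G g \<and> H \<noteq> carrier G}"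
  have "F \<subseteq> Pow (carrier G)" unfolding F_def centralizer_def by auto
  then have "finite F" using fin finite_subset by blast
  have Fs: "subgroup H G" if "H \<in> F" for H using that centralizer_subgroup unfolding F_def by auto
  have hF: "centralizer G h \<in> F" using gh unfolding F_def centralizer_def by fast
  have "x \<in> (\<Union>H\<in>F. \<Union>g\<in>carrier G. conj_subgroup G H g)" if x: "x \<in> carrier G" for x
  proof -
    have "\<exists>H\<in>F. x \<in> H"
    proof (cases "centralizer G x = carrier G")
      case True
      then have "h \<otimes> x = x \<otimes> h" using gh(2) unfolding centralizer_def by blast
      then have "x \<in> centralizer G h" using x unfolding centralizer_def by auto
      then show ?thesis using hF by blast
    next
      case False
      then have "centralizer G x \<in> F" unfolding F_def using x by blast
      moreover have "x \<in> centralizer G x" using x unfolding centralizer_def by simp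
      ultimately show ?thesis by blast
    qed
    then show ?thesis using in_conj_subgroup_one Fs by blast
  qed
  then have "normal_cover G F" unfolding normal_cover_def using \<open>finite F\<close> Fs unfolding F_def by auto
  then obtain B where "basic_set G B" using basic_set_if_normal_cover by blast
  then have "\<exists>k B. basic_set G B \<and> card B = k" by blast
  then have "\<exists>B. basic_set G B \<and> card B = gamma_num G"
    unfolding gamma_num_def by (rule LeastI_ex)
  then show ?thesis using that by blast
qed

section \<open>Subgroups of S_n and A_n as permutation groups\<close>

text \<open>Both groups are handled together, since their operations agree; they differ below only
  in the parity of the chosen elements.\<close>

definition sym_or_alt :: "nat \<Rightarrow> (nat \<Rightarrow> nat) monoid \<Rightarrow> bool" where
  "sym_or_alt n G \<longleftrightarrow> G = sym_group n \<or> G = alt_group n"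

lemma sym_or_alt_group: "sym_or_alt n G \<Longrightarrow> group G"
  unfolding sym_or_alt_def using sym_group_is_group alt_group_is_group by auto

lemma sym_or_alt_simps:
  assumes "sym_or_alt n G"
  shows "mult G = (\<circ>)" "one G = id" "g \<in> carrier G \<Longrightarrow> inv\<^bsub>G\<^esub> g = inv' g"
    "g \<in> carrier G \<Longrightarrow> g permutes {1..n}"
  using assms unfolding sym_or_alt_def
  by (auto simp: sym_group_mult alt_group_mult sym_group_one alt_group_one alt_group_inv_equality
      sym_group_carrier alt_group_carrier)

lemma sym_or_alt_finite: "sym_or_alt n G \<Longrightarrow> finite (carrier G)"
  using sym_or_alt_simps(4) finite_permutations[of "{1..n}"] finite_subset[of "carrier G" "{p. p permutes {1..n}}"] by blast

lemma perm_group_of_subgroup: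
  assumes G: "sym_or_alt n G" and H: "subgroup H G"
  shows "perm_group {1..n} H"
proof
  have sub: "H \<subseteq> carrier G" by (rule subgroup.subset[OF H])
  show "finite {1..n}" by simp
  show "g permutes {1..n}" if "g \<in> H" for g using that sub sym_or_alt_simps(4)[OF G] by blast
  show "id \<in> H" using subgroup.one_closed[OF H] sym_or_alt_simps(2)[OF G] by simp
  show "g \<circ> h \<in> H" if "g \<in> H" "h \<in> H" for g h
    using subgroup.m_closed[OF H that] sym_or_alt_simps(1)[OF G] by simp
  show "inv' g \<in> H" if "g \<in> H" for g
    using subgroup.m_inv_closed[OF H that] sym_or_alt_simps(3)[OF G, of g] sub that by auto
qed

text \<open>The three-cycles generate A_n.\<close>

lemma alt_group_subset:
  assumes H: "perm_group {1..n} H"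
    and cyc: "\<And>u v w. distinct [u, v, w] \<Longrightarrow> {u, v, w} \<subseteq> {1..n} \<Longrightarrow> cycle_of_list [u, v, w] \<in> H"
  shows "carrier (alt_group n) \<subseteq> H"
proof
  interpret perm_group "{1..n}" H by (rule H)
  have T: "three_cycles n \<subseteq> H"
  proof
    fix p assume "p \<in> three_cycles n"
    then obtain cs where cs: "p = cycle_of_list cs" "cycle cs" "length cs = 3" "set cs \<subseteq> {1..n}" by blast
    then obtain u v w where "cs = [u, v, w]" by (auto simp: length_Suc_conv numeral_3_eq_3)
    then show "p \<in> H" using cs cyc[of u v w] by simp
  qed
  fix p assume "p \<in> carrier (alt_group n)"
  then have "p \<in> generate (alt_group n) (three_cycles n)" using alt_group_carrier_as_three_cycles by simp
  then show "p \<in> H"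
  proof induction
    case (inv h)
    then have "inv\<^bsub>alt_group n\<^esub> h = inv' h" using alt_group_inv_equality three_cycles_incl by blast
    then show ?case using inv T inv_G by auto
  next
    case one
    show ?case by (simp only: alt_group_one id_G)
  next
    case (eng h k)
    then show ?case by (simp only: alt_group_mult comp_G)
  qed (use T in blast)
qed

section \<open>Subgroups with an invariant set or containing A_n\<close>

text \<open>Without a proper invariant set H is transitive. The non-divisibilities by p isolate the
  p-cycle as a power of x, those of n make H primitive, and the size bound on p yields a
  three-cycle.\<close>

lemma invariant_or_alt_if_prime_cycle:
  assumes H: "perm_group {1..n} H" and x: "cycles3 {1..n} us vs ws x" "x \<in> H"
    and p: "prime (length us)" "\<not> length us dvd n" "\<not> length us dvd length vs"
      "ws = [] \<or> \<not> length us dvd length ws" "2 * length us \<le> n + 1"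
    and vs: "length us + length vs dvd n \<Longrightarrow> ws = []"
    and ws: "length us + length ws dvd n \<Longrightarrow> ws = []"
    and n: "4 \<le> n"
  shows "carrier (alt_group n) \<subseteq> H \<or> (\<exists>X. perm_group.invariant {1..n} H X \<and> X \<noteq> {} \<and> X \<noteq> {1..n})"
proof (rule disjCI)
  interpret perm_group "{1..n}" H by (rule H)
  assume "\<not> (\<exists>X. invariant X \<and> X \<noteq> {} \<and> X \<noteq> {1..n})"
  then have J: "jordan {1..n}" using transitive_if_no_invariant by blast
  have us: "distinct us" "set us \<subseteq> {1..n}" using x unfolding cycles3_def by auto
  have c: "cycle_of_list us \<in> H"
  \<comment> \<open>The number M must be nonzero, so an empty ws contributes the factor 1.\<close>
  proof (rule cycle_in_group[OF x, of "length vs * (if ws = [] then 1 else length ws)"])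
    show "coprime (length us) (length vs * (if ws = [] then 1 else length ws))"
      using p(1,3,4) by (auto simp: prime_imp_coprime)
    show "length vs * (if ws = [] then 1 else length ws) \<noteq> 0" using p(3) by auto
  qed auto
  have JU: "jordan (set us)" by (rule jordan_cycle[OF us c])
  have cu: "card (set us) = length us" using us distinct_card by blast
  have ne: "set us \<noteq> {1..n}" using p(5) n cu by auto
  have prim: "primitive"
    using primitive_long_cycle[OF J x c p(1)] p(2) vs ws by simp
  have "2 \<le> length us" using p(1) prime_ge_2_nat by blast
  then obtain x y z where "distinct [x, y, z]" "{x, y, z} \<subseteq> {1..n}" "cycle_of_list [x, y, z] \<in> H"
    using three_cycle_exists[OF prim JU] cu p ne by auto
  then show "carrier (alt_group n) \<subseteq> H"
    using alt_group_subset[OF H] all_three_cycles[OF prim] n by simp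
qed

text \<open>Since n is prime, transitivity already gives primitivity, and k and n - k are coprime.
  So both cycles are powers of x and both supports are Jordan sets, which replaces primality of
  k.\<close>

lemma invariant_or_alt_if_prime_degree:
  assumes H: "perm_group {1..n} H" and x: "cycles3 {1..n} us vs [] x" "x \<in> H"
    and k: "2 \<le> length us" "2 * length us < n" and n: "prime n" "4 \<le> n"
  shows "carrier (alt_group n) \<subseteq> H \<or> (\<exists>X. perm_group.invariant {1..n} H X \<and> X \<noteq> {} \<and> X \<noteq> {1..n})"
proof (rule disjCI)
  interpret perm_group "{1..n}" H by (rule H)
  assume "\<not> (\<exists>X. invariant X \<and> X \<noteq> {} \<and> X \<noteq> {1..n})"
  then have J: "jordan {1..n}" using transitive_if_no_invariant by blast
  have us: "distinct us" "set us \<subseteq> {1..n}" and v: "distinct vs" "set vs = {1..n} - set us" "set us \<inter> set vs = {}"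
    using x unfolding cycles3_def by auto
  have nlen: "n = length us + length vs" using cycles3_card[OF x(1)] by simp
  have co: "coprime (length us) (length vs)"
  proof -
    have "\<not> n dvd length us" using k by (intro nat_dvd_not_less) auto
    then have "coprime n (length us)" using prime_imp_coprime n(1) by blast
    then show ?thesis unfolding nlen by (simp add: coprime_iff_gcd_eq_1 gcd.commute)
  qed
  have lv: "length vs \<noteq> 0" and lu: "us \<noteq> []" using k nlen by auto
  have x': "cycles3 {1..n} vs us [] x"
    using x cycles_commute[OF us(1) v(1,3)] unfolding cycles3_def by auto
  have c: "cycle_of_list us \<in> H"
    using cycle_in_group[OF x, of "length vs"] co lv by simp
  have c': "cycle_of_list vs \<in> H"
    using cycle_in_group[OF x' x(2), of "length us"] co lu by (simp add: coprime_commute)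
  have JU: "jordan (set us)" by (rule jordan_cycle[OF us c])
  have JV: "jordan ({1..n} - set us)" using jordan_cycle[OF v(1) _ c'] v(2) by auto
  have cu: "card (set us) = length us" "card ({1..n} - set us) = length vs"
    using us v distinct_card by metis+
  have ne: "set us \<noteq> {1..n}" using k cu by auto
  have prim: "primitive"
    by (rule primitive_prime_degree[OF J]) (use n in simp)
  obtain x y z where "distinct [x, y, z]" "{x, y, z} \<subseteq> {1..n}" "cycle_of_list [x, y, z] \<in> H"
    using three_cycle_exists[OF prim JU] cu k ne co JV by auto
  then show "carrier (alt_group n) \<subseteq> H"
    using alt_group_subset[OF H] all_three_cycles[OF prim] n by simp
qed

text \<open>Each element \<open>x i\<close> forces the member of the basic set containing a conjugate of it to have an
  invariant set of one of the sizes in \<open>S i\<close>.\<close>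

lemma card_le_basic_set:
  assumes G: "sym_or_alt n G" and B: "basic_set G B" and fI: "finite I"
    and x: "\<And>i. i \<in> I \<Longrightarrow> x i \<in> carrier G \<and> (\<exists>us vs ws. cycles3 {1..n} us vs ws (x i) \<and>
        length us = p i \<and> length vs = q i \<and> length ws = r i)"
    and inv: "\<And>i H us vs ws y. i \<in> I \<Longrightarrow> subgroup H G \<Longrightarrow> H \<noteq> carrier G \<Longrightarrow> y \<in> H \<Longrightarrow>
        cycles3 {1..n} us vs ws y \<Longrightarrow> length us = p i \<Longrightarrow> length vs = q i \<Longrightarrow> length ws = r i \<Longrightarrow>
        \<exists>X. perm_group.invariant {1..n} H X \<and> X \<noteq> {} \<and> X \<noteq> {1..n}"
    and M: "\<And>s. 0 < s \<Longrightarrow> s < n \<Longrightarrow>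
        card {i \<in> I. s \<in> {p i, q i, r i, p i + q i, p i + r i, q i + r i}} \<le> M"
  shows "card I \<le> M * card B"
proof -
  interpret G: group G by (rule sym_or_alt_group[OF G])
  have fB: "finite B" and BH: "\<And>H. H \<in> B \<Longrightarrow> subgroup H G \<and> H \<noteq> carrier G"
    using B unfolding basic_set_def by auto
  have cov: "carrier G \<subseteq> (\<Union>H\<in>B. \<Union>g\<in>carrier G. conj_subgroup G H g)"
    using B unfolding basic_set_def by (intro equalityD1) metis
  define Q where "Q i H \<longleftrightarrow> H \<in> B \<and> (\<exists>us vs ws y. y \<in> H \<and> cycles3 {1..n} us vs ws y \<and>
      length us = p i \<and> length vs = q i \<and> length ws = r i)" for i H
  have "\<exists>H. Q i H" if iI: "i \<in> I" for i
  proof -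
    have xi: "x i \<in> carrier G" using x iI by blast
    then obtain H g where H: "H \<in> B" "g \<in> carrier G" "x i \<in> conj_subgroup G H g"
      using cov by blast
    have sub: "H \<subseteq> carrier G" using BH[OF H(1)] subgroup.subset by blast
    obtain h where h: "h \<in> H" "x i = inv\<^bsub>G\<^esub> g \<otimes>\<^bsub>G\<^esub> h \<otimes>\<^bsub>G\<^esub> g"
      using G.conj_subgroup_iff[OF sub H(2)] H(3) by blast
    have gp: "g permutes {1..n}" using sym_or_alt_simps(4)[OF G H(2)] .
    have hx: "h = g \<circ> x i \<circ> inv' g"
      using h(2) sym_or_alt_simps(1,3)[OF G] H(2) permutes_inverses[OF gp] by (auto simp: fun_eq_iff)
    obtain us vs ws where us: "cycles3 {1..n} us vs ws (x i)" "length us = p i" "length vs = q i" "length ws = r i"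
      using x[OF iI] by blast
    have "cycles3 {1..n} (map g us) (map g vs) (map g ws) h"
      using cycles3_conj[OF us(1) gp] hx by simp
    moreover have "length (map g us) = p i" "length (map g vs) = q i" "length (map g ws) = r i" using us by auto
    ultimately show ?thesis unfolding Q_def using H(1) h(1) by blast
  qed
  \<comment> \<open>To each i, f assigns a member of B containing a conjugate of x i; it remains to
    bound the fibres of f.\<close>
  then obtain f where f: "\<And>i. i \<in> I \<Longrightarrow> Q i (f i)" by metis
  have fib: "card {i \<in> I. f i = H} \<le> M" if HB: "H \<in> B" for H
  proof (cases "{i \<in> I. f i = H} = {}")
    case False
    then obtain j where j: "j \<in> I" "f j = H" by blast
    interpret perm_group "{1..n}" H using perm_group_of_subgroup[OF G] BH[OF HB] by blast
    \<comment> \<open>One invariant set X of H serves for the whole fibre: its size is a partial sum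
      of the cycle lengths for every i with f i = H.\<close>
    obtain X where X: "invariant X" "X \<noteq> {}" "X \<noteq> {1..n}"
      using f[OF j(1)] inv[OF j(1)] BH[OF HB] unfolding Q_def j(2) by metis
    have XW: "X \<subseteq> {1..n}" using X unfolding invariant_def by blast
    then have fX: "finite X" using finite_subset by blast
    have s: "0 < card X" "card X < n"
      using X fX XW psubset_card_mono[of "{1..n}" X] by (auto simp: card_gt_0_iff)
    have "card X \<in> {p i, q i, r i, p i + q i, p i + r i, q i + r i}" if i: "i \<in> I" "f i = H" for i
    proof -
      obtain us vs ws y where y: "y \<in> H" "cycles3 {1..n} us vs ws y" "length us = p i" "length vs = q i" "length ws = r i"
        using f[OF i(1)] unfolding Q_def i(2) by blast
      have "y ` X \<subseteq> X" using X(1) y(1) unfolding invariant_def by blast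
      then show ?thesis
        by (rule cycles3_invariant_card[OF y(2) _ XW]) (use s y in auto)
    qed
    then have "{i \<in> I. f i = H} \<subseteq> {i \<in> I. card X \<in> {p i, q i, r i, p i + q i, p i + r i, q i + r i}}"
      by blast
    then have "card {i \<in> I. f i = H} \<le> card {i \<in> I. card X \<in> {p i, q i, r i, p i + q i, p i + r i, q i + r i}}"
      using fI by (intro card_mono) auto
    then show ?thesis using M[OF s] by linarith
  next
    case True
    then show ?thesis by (metis card.empty le0)
  qed
  have "I = (\<Union>H\<in>B. {i \<in> I. f i = H})" using f unfolding Q_def by blast
  then have "card I \<le> (\<Sum>H\<in>B. card {i \<in> I. f i = H})"
    using card_UN_le[OF fB, of "\<lambda>H. {i \<in> I. f i = H}"] by metis
  also have "\<dots> \<le> (\<Sum>H\<in>B. M)" using fib by (intro sum_mono) auto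
  finally show ?thesis by (simp add: mult.commute)
qed

section \<open>Primes not dividing a given number\<close>

text \<open>Counting after Erdos: m <= x is determined by its square part, at most sqrt x, and the
  set of primes dividing its squarefree part. So x <= 2^P sqrt x, where P is the number of primes up
  to x.\<close>

lemma le_four_power_card_primes:
  "(x::nat) \<le> 4 ^ card {p. prime p \<and> p \<le> x}"
proof (cases "x = 0")
  case False
  define P where "P = {p::nat. prime p \<and> p \<le> x}"
  define t where "t = floor_sqrt x"
  have fP: "finite P" unfolding P_def by simp
  have "x = card {1..x}" by simp
  also have "\<dots> \<le> card (Pow P \<times> {1..t})"
  proof (rule card_inj_on_le)
    show "inj_on (\<lambda>m. (prime_factors (squarefree_part m), square_part m)) {1..x}"
    proof (rule inj_onI)
      fix m k :: nat assume mk: "m \<in> {1..x}" "k \<in> {1..x}"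
        "(prime_factors (squarefree_part m), square_part m) = (prime_factors (squarefree_part k), square_part k)"
      \<comment> \<open>A squarefree number is the product of its prime factors, so the set of these
        determines it.\<close>
      have sq: "squarefree_part j = \<Prod>(prime_factors (squarefree_part j))" for j :: nat
      proof -
        have "squarefree (squarefree_part j)" by simp
        then have "\<forall>p\<in>prime_factors (squarefree_part j). multiplicity p (squarefree_part j) = 1"
          using squarefree_factorial_semiring'[OF squarefree_part_nonzero] by blast
        then have "(\<Prod>p\<in>prime_factors (squarefree_part j). p ^ multiplicity p (squarefree_part j)) =
            \<Prod>(prime_factors (squarefree_part j))"
          by (intro prod.cong) auto
        moreover have "0 < squarefree_part j" using squarefree_part_nonzero[of j] by (simp only: neq0_conv)
        ultimately show ?thesis using prime_factorization_nat[of "squarefree_part j"] by simp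
      qed
      have "squarefree_part m = squarefree_part k" using sq[of m] sq[of k] mk(3) by simp
      then show "m = k" using squarefree_decompose[of m] squarefree_decompose[of k] mk(3) by simp
    qed
    show "(\<lambda>m. (prime_factors (squarefree_part m), square_part m)) ` {1..x} \<subseteq> Pow P \<times> {1..t}"
    proof (rule image_subsetI)
      fix m assume m: "m \<in> {1..x}"
      have "squarefree_part m dvd m" using squarefree_decompose[of m] by (metis dvd_triv_left)
      then have "p dvd m" if "p \<in> prime_factors (squarefree_part m)" for p
        using that by (meson dvd_trans in_prime_factors_imp_dvd)
      then have "p \<le> x" if "p \<in> prime_factors (squarefree_part m)" for p
        using that m dvd_imp_le[of p m] by fastforce
      then have "prime_factors (squarefree_part m) \<subseteq> P"
        unfolding P_def by auto
      moreover have "square_part m ^ 2 \<le> x"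
        using m dvd_imp_le[OF square_part_square_dvd[of m]] by simp
      then have "square_part m \<le> t" unfolding t_def by (simp add: le_floor_sqrt_iff)
      moreover have "square_part m \<noteq> 0" using m by simp
      then have "0 < square_part m" by (simp only: neq0_conv)
      ultimately show "(prime_factors (squarefree_part m), square_part m) \<in> Pow P \<times> {1..t}"
        by (simp add: Suc_le_eq)
    qed
  qed (use fP in simp)
  finally have "x \<le> 2 ^ card P * t" using fP by (simp add: card_cartesian_product card_Pow)
  then have "x * x \<le> (2 ^ card P * t) * (2 ^ card P * t)" by (intro mult_mono) auto
  also have "\<dots> = 4 ^ card P * t\<^sup>2"
    by (simp add: power2_eq_square power_mult_distrib[symmetric] algebra_simps flip: power_mult_distrib)
  also have "\<dots> \<le> 4 ^ card P * x" unfolding t_def by simp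
  finally show ?thesis using False unfolding P_def by simp
qed simp

text \<open>There are at least log_4 (n div 4) primes up to n div 4. Those above C that divide N
  have product at most n^3 and use up only about half of this number. The numbers up to C and K
  further primes cannot make up the rest for large n.\<close>

lemma many_primes_not_dividing:
  obtains n0 :: nat where
    "\<And>n N. n0 \<le> n \<Longrightarrow> 0 < N \<Longrightarrow> N \<le> n ^ 3 \<Longrightarrow> K < card {p. prime p \<and> \<not> p dvd N \<and> 4 * p \<le> n}"
proof -
  \<comment> \<open>The value 16^3 turns C^d <= n^3 into 16^d <= n, that is 4^d <= sqrt n, for d the
    number of large primes dividing N.\<close>
  define C :: nat where "C = 16 ^ 3"
  have "K < card {p. prime p \<and> \<not> p dvd N \<and> 4 * p \<le> n}"
    if n: "16 ^ (K + Suc C + 2) + 4 \<le> n" and N: "0 < N" "N \<le> n ^ 3" for n N :: nat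
  proof (rule ccontr)
    define S where "S = {p. prime p \<and> \<not> p dvd N \<and> 4 * p \<le> n}"
    define D where "D = {p. prime p \<and> C < p \<and> p dvd N}"
    define x where "x = n div 4"
    assume "\<not> K < card {p. prime p \<and> \<not> p dvd N \<and> 4 * p \<le> n}"
    then have K: "card S \<le> K" unfolding S_def by simp
    have fS: "finite S" by (rule finite_subset[of _ "{..n}"]) (auto simp: S_def)
    have fD: "finite D" by (rule finite_subset[of _ "{..N}"]) (use N in \<open>auto simp: D_def intro: dvd_imp_le\<close>)
    have "\<Prod>D dvd (\<Prod>p\<in>prime_factors N. p ^ multiplicity p N)"
    proof (rule prod_dvd_prod_subset2)
      show "D \<subseteq> prime_factors N" using N unfolding D_def by (auto simp: prime_factors_dvd)
      show "p dvd p ^ multiplicity p N" if "p \<in> D" for p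
        using that N unfolding D_def by (intro dvd_power disjI1) (auto simp: prime_multiplicity_gt_zero_iff)
    qed simp
    then have "\<Prod>D dvd N" using prime_factorization_nat[OF N(1)] by simp
    then have "\<Prod>D \<le> n ^ 3" using N dvd_imp_le le_trans by blast
    moreover have "(\<Prod>p\<in>D. C) \<le> \<Prod>D" by (intro prod_mono) (auto simp: D_def)
    ultimately have "C ^ card D \<le> n ^ 3" by simp
    moreover have "C ^ card D = (16 ^ card D) ^ 3" unfolding C_def by (simp only: power_mult[symmetric] mult.commute)
    ultimately have D: "16 ^ card D \<le> n" by (simp add: power_mono_iff)
    have "{p. prime p \<and> p \<le> x} \<subseteq> S \<union> {..C} \<union> D"
      unfolding S_def D_def x_def by auto
    then have "card {p. prime p \<and> p \<le> x} \<le> card (S \<union> {..C} \<union> D)"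
      using fS fD by (intro card_mono) auto
    also have "\<dots> \<le> card S + Suc C + card D"
      using card_Un_le[of "S \<union> {..C}" D] card_Un_le[of S "{..C}"] by simp
    finally have "card {p. prime p \<and> p \<le> x} \<le> K + Suc C + card D" using K by linarith
    then have "(4::nat) ^ card {p. prime p \<and> p \<le> x} \<le> 4 ^ (K + Suc C + card D)"
      by (intro power_increasing) auto
    then have "x \<le> 4 ^ (K + Suc C) * 4 ^ card D"
      using le_four_power_card_primes[of x] unfolding power_add by linarith
    moreover have "4 \<le> n" using n by simp
    then have "n \<le> 8 * x" unfolding x_def by presburger
    ultimately have "n \<le> (8 * 4 ^ (K + Suc C)) * 4 ^ card D" by linarith
    then have "n * n \<le> ((8 * 4 ^ (K + Suc C)) * 4 ^ card D) * ((8 * 4 ^ (K + Suc C)) * 4 ^ card D)"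
      by (intro mult_mono) auto
    also have "\<dots> = 64 * 16 ^ (K + Suc C) * 16 ^ card D"
    proof -
      have "(4::nat) ^ m * 4 ^ m = 16 ^ m" for m by (simp flip: power_mult_distrib)
      moreover have "((8 * a) * b) * ((8 * a) * b) = 64 * (a * a) * (b * b)" for a b :: nat by simp
      ultimately show ?thesis by (simp only:)
    qed
    also have "\<dots> \<le> 64 * 16 ^ (K + Suc C) * n" using D by (intro mult_left_mono) auto
    finally have "n \<le> 64 * 16 ^ (K + Suc C)" using n by simp
    also have "\<dots> \<le> 16 ^ (K + Suc C + 2)" by (simp only: power_add) simp
    finally show False using n by linarith
  qed
  then show ?thesis using that by blast
qed

section \<open>Lower bounds\<close>

lemma evenperm_cycle:
  assumes "distinct cs"
  shows "evenperm (cycle_of_list cs) \<longleftrightarrow> even (length cs - 1)"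
  using evenperm_unique[OF swapidseq_ext_imp_swapidseq[OF swapidseq_ext_of_cycles[OF assms]] refl] .

text \<open>Truncated subtraction lets an empty list contribute 0. Hence two nonempty cycles give
  the parity of n - 2 and three that of n - 3.\<close>

lemma evenperm_cycles3:
  assumes "cycles3 W us vs ws x"
  shows "evenperm x \<longleftrightarrow> even (length us - 1 + (length vs - 1) + (length ws - 1))"
proof -
  have d: "distinct us" "distinct vs" "distinct ws"
    and x: "x = cycle_of_list us \<circ> cycle_of_list vs \<circ> cycle_of_list ws"
    using assms unfolding cycles3_def by auto
  have "evenperm x \<longleftrightarrow>
      ((evenperm (cycle_of_list us) = evenperm (cycle_of_list vs)) = evenperm (cycle_of_list ws))"
    unfolding x by (simp only: evenperm_comp permutation_compose permutation_of_cycle)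
  then show ?thesis
    by (simp only: evenperm_cycle[OF d(1)] evenperm_cycle[OF d(2)] evenperm_cycle[OF d(3)] even_add)
qed

lemma cycles3_exists:
  assumes "p + q + r = n"
  obtains us vs ws x where "cycles3 {1..n} us vs ws x" "length us = p" "length vs = q" "length ws = r"
proof
  let ?us = "[1..<Suc p]" and ?vs = "[Suc p..<Suc (p + q)]" and ?ws = "[Suc (p + q)..<Suc n]"
  show "cycles3 {1..n} ?us ?vs ?ws (cycle_of_list ?us \<circ> cycle_of_list ?vs \<circ> cycle_of_list ?ws)"
    unfolding cycles3_def using assms by auto
qed (use assms in auto)

text \<open>In S_n an odd element y of H gives every odd g as an even permutation times y. It is
  used to see that a proper H containing y does not contain A_n.\<close>

lemma subgroup_eq_if_alt_subset:
  assumes G: "sym_or_alt n G" and H: "subgroup H G" and alt: "carrier (alt_group n) \<subseteq> H"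
    and y: "y \<in> H" "G = sym_group n \<Longrightarrow> \<not> evenperm y"
  shows "H = carrier G"
proof (rule antisym[OF subgroup.subset[OF H]])
  interpret perm_group "{1..n}" H by (rule perm_group_of_subgroup[OF G H])
  show "carrier G \<subseteq> H"
  proof (cases "G = sym_group n")
    case True
    show ?thesis
    proof
      fix g assume "g \<in> carrier G"
      then have g: "g permutes {1..n}" using sym_or_alt_simps(4)[OF G] by blast
      have yp: "y permutes {1..n}" using permutes_W y(1) by blast
      have perm: "permutation g" "permutation (inv' y)" "permutation y"
        using g yp permutes_inv[OF yp] permutation_permutes by blast+
      show "g \<in> H"
      proof (cases "evenperm g")
        case False
        have "evenperm (g \<circ> inv' y)"
          using False y(2) True perm by (simp add: evenperm_comp evenperm_inv)
        moreover have "g \<circ> inv' y permutes {1..n}" using g permutes_inv[OF yp] by (rule permutes_compose[rotated])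
        ultimately have "g \<circ> inv' y \<in> H" using alt alt_group_carrier by blast
        then have "(g \<circ> inv' y) \<circ> y \<in> H" using y(1) by (rule comp_G)
        moreover have "(g \<circ> inv' y) \<circ> y = g" using permutes_inv_o(2)[OF yp] by (simp only: comp_assoc comp_id)
        ultimately show ?thesis by simp
      qed (use g alt alt_group_carrier in blast)
    qed
  qed (use G alt in \<open>simp add: sym_or_alt_def\<close>)
qed

lemma card_list_le:
  assumes "S \<subseteq> set xs"
  shows "card S \<le> length xs"
  using card_mono[OF _ assms] card_length[of xs] by simp

text \<open>The test element for p has cycle lengths p, q p, r p. The factor n in the product
  secures primitivity, while n - 1 and n + 1 keep p from dividing the two near-halves of n -
  p.\<close>

lemma card_primes_le_basic_set:
  assumes G: "sym_or_alt n G" and n: "4 \<le> n" and B: "basic_set G B"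
  shows "card {p. prime p \<and> \<not> p dvd (n - 1) * n * (n + 1) \<and> 4 * p \<le> n} \<le> 8 * card B"
proof -
  define I where "I = {p. prime p \<and> \<not> p dvd (n - 1) * n * (n + 1) \<and> 4 * p \<le> n}"
  \<comment> \<open>Two cycles give an even permutation iff n is even, three iff n is odd. The
    choice makes the element odd in S_n and even in A_n.\<close>
  define two where "two \<longleftrightarrow> (G = sym_group n \<longleftrightarrow> odd n)"
  define q where "q p = (if two then n - p else (n - p) div 2)" for p
  define r where "r p = n - p - q p" for p
  have symalt: "G = sym_group n \<or> G = alt_group n \<and> G \<noteq> sym_group n" using G unfolding sym_or_alt_def by blast
  have fI: "finite I" by (rule finite_subset[of _ "{..n}"]) (auto simp: I_def)
  have pI: "prime p" "\<not> p dvd n" "\<not> p dvd n - 1" "\<not> p dvd n + 1" "4 * p \<le> n" "2 \<le> p" if "p \<in> I" for p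
  proof -
    show p: "prime p" "4 * p \<le> n" "2 \<le> p" using that prime_ge_2_nat unfolding I_def by blast+
    have "\<not> p dvd (n - 1) * n * (n + 1)" using that unfolding I_def by blast
    then show "\<not> p dvd n" "\<not> p dvd n - 1" "\<not> p dvd n + 1"
      by (meson dvd_mult dvd_mult2)+
  qed
  have odd_p: "odd p" if "p \<in> I" for p
  proof
    assume "even p"
    then have "p = 2" using prime_odd_nat[OF pI(1)[OF that]] pI(6)[OF that] by fastforce
    then show False using pI(2,4)[OF that] by simp
  qed
  have two_iff: "two \<Longrightarrow> q p = n - p \<and> r p = 0" for p unfolding q_def r_def by simp
  have three: "q p + r p = n - p \<and> (2 * q p = n - p \<or> 2 * q p + 1 = n - p) \<and> q p \<noteq> 0 \<and> r p \<noteq> 0"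
    if "\<not> two" "p \<in> I" for p
    using that(1) pI(5,6)[OF that(2)] unfolding q_def r_def by auto
  have sum: "p + q p + r p = n" if "p \<in> I" for p
    using pI(5,6)[OF that] two_iff three[OF _ that] by (cases two) auto
  have ev: "evenperm x \<longleftrightarrow> G \<noteq> sym_group n"
    if p: "p \<in> I" and x: "cycles3 {1..n} us vs ws x" "length us = p" "length vs = q p" "length ws = r p"
    for p us vs ws x
  proof (cases two)
    case True
    have "evenperm x \<longleftrightarrow> even (p - 1 + (n - p - 1))"
      using evenperm_cycles3[OF x(1)] x(2-4) two_iff[OF True, of p] by simp
    moreover have "p - 1 + (n - p - 1) + 2 = n" using pI(5,6)[OF p] by linarith
    ultimately show ?thesis using True unfolding two_def by (metis even_add dvd_refl)
  next
    case False
    have "p - 1 + (q p - 1) + (r p - 1) + 3 = n" using three[OF False p] sum[OF p] pI(6)[OF p] by linarith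
    then have "even (p - 1 + (q p - 1) + (r p - 1)) \<longleftrightarrow> odd n" by presburger
    then show ?thesis using evenperm_cycles3[OF x(1)] x(2-4) False unfolding two_def by auto
  qed
  have "\<exists>x. x \<in> carrier G \<and> (\<exists>us vs ws. cycles3 {1..n} us vs ws x \<and>
        length us = p \<and> length vs = q p \<and> length ws = r p)" if p: "p \<in> I" for p
  proof -
    obtain us vs ws x where x: "cycles3 {1..n} us vs ws x" "length us = p" "length vs = q p" "length ws = r p"
      using cycles3_exists[OF sum[OF p]] .
    have "x \<in> carrier G"
      using symalt ev[OF p x] cycles3_permutes[OF x(1)] by (auto simp: sym_group_carrier alt_group_carrier)
    then show ?thesis using x by blast
  qed
  then obtain x where x: "\<And>p. p \<in> I \<Longrightarrow> x p \<in> carrier G \<and> (\<exists>us vs ws. cycles3 {1..n} us vs ws (x p) \<and>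
        length us = p \<and> length vs = q p \<and> length ws = r p)" by metis
  have "card I \<le> 8 * card B"
  proof (rule card_le_basic_set[OF G B fI x])
    fix p H us vs ws y
    assume p: "p \<in> I" and H: "subgroup H G" "H \<noteq> carrier G" and y: "y \<in> H"
      and c: "cycles3 {1..n} us vs ws y" and len: "length us = p" "length vs = q p" "length ws = r p"
    \<comment> \<open>With three cycles 2 q + p is n or n - 1; likewise 2 r + p is n or n + 1 below.
      None of these is divisible by p.\<close>
    have "\<not> p dvd 2 * q p"
    proof (cases two)
      case True
      then have "q p = n - p" using two_iff by blast
      moreover have "\<not> p dvd n - p" using pI(2,5)[OF p] by (simp add: dvd_minus_self)
      moreover have "\<not> p dvd 2" using odd_p[OF p] pI(6)[OF p] dvd_imp_le[of p 2] by (cases "p = 2") auto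
      ultimately show ?thesis using pI(1)[OF p] by (simp add: prime_dvd_mult_iff)
    next
      case False
      then consider "2 * q p + p = n" | "2 * q p + p = n - 1" using three[OF False p] pI(5,6)[OF p] by fastforce
      then show ?thesis using pI(2,3)[OF p] by cases (metis dvd_add_triv_right_iff)+
    qed
    then have pq: "\<not> p dvd q p" by (meson dvd_mult)
    have pr: "ws = [] \<or> \<not> p dvd r p"
    proof (cases two)
      case False
      then consider "2 * r p + p = n" | "2 * r p + p = n + 1" using three[OF False p] sum[OF p] by linarith
      then have "\<not> p dvd 2 * r p" using pI(2,4)[OF p] by cases (metis dvd_add_triv_right_iff)+
      then show ?thesis by (meson dvd_mult)
    qed (use two_iff[of p] len in simp)
    \<comment> \<open>The block sizes p + q and p + r lie strictly between n / 2 and n, so they do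
      not divide n.\<close>
    have half: "\<not> m dvd n" if "n < 2 * m" "m < n" for m
    proof
      assume "m dvd n"
      then obtain k where k: "n = m * k" by blast
      then have "k \<noteq> 0" "k \<noteq> 1" using that by auto
      then have "m * 2 \<le> m * k" by (intro mult_le_mono2) linarith
      then show False using k that by simp
    qed
    have "carrier (alt_group n) \<subseteq> H \<or> (\<exists>X. perm_group.invariant {1..n} H X \<and> X \<noteq> {} \<and> X \<noteq> {1..n})"
    proof (rule invariant_or_alt_if_prime_cycle[OF perm_group_of_subgroup[OF G H(1)] c y])
      show "prime (length us)" "\<not> length us dvd n" "2 * length us \<le> n + 1"
        using pI[OF p] len by auto
      show "\<not> length us dvd length vs" "ws = [] \<or> \<not> length us dvd length ws" using pq pr len by auto
      show "ws = []" if "length us + length vs dvd n"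
      proof (cases two)
        case False
        have "n < 2 * (p + q p)" "p + q p < n" using three[OF False p] sum[OF p] pI(6)[OF p] by auto
        then show ?thesis using half that len by simp
      qed (use two_iff[of p] len in simp)
      show "ws = []" if "length us + length ws dvd n"
      proof (cases two)
        case False
        have "n < 2 * (p + r p)" "p + r p < n" using three[OF False p] sum[OF p] pI(6)[OF p] by auto
        then show ?thesis using half that len by simp
      qed (use two_iff[of p] len in simp)
    qed (rule n)
    moreover have "\<not> carrier (alt_group n) \<subseteq> H"
      using subgroup_eq_if_alt_subset[OF G H(1) _ y] ev[OF p c len] H(2) by blast
    ultimately show "\<exists>X. perm_group.invariant {1..n} H X \<and> X \<noteq> {} \<and> X \<noteq> {1..n}" by blast
  next
    fix s assume s: "0 < s" "s < n"
    \<comment> \<open>Up to replacing s by n - s, s is p, q or r. Since p + 2 q and p + 2 r lie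
      within 1 of n, each of s and n - s leaves four candidates for p.\<close>
    let ?L = "[s, n - s, n - 2 * s, n - 2 * s - 1, n + 1 - 2 * s,
        n - 2 * (n - s), n - 2 * (n - s) - 1, n + 1 - 2 * (n - s)]"
    have "{p \<in> I. s \<in> {p, q p, r p, p + q p, p + r p, q p + r p}} \<subseteq> set ?L"
    proof
      fix p assume "p \<in> {p \<in> I. s \<in> {p, q p, r p, p + q p, p + r p, q p + r p}}"
      then have p: "p \<in> I" and sp: "s = p \<or> s = q p \<or> s = r p \<or> s = p + q p \<or> s = p + r p \<or> s = q p + r p"
        by auto
      show "p \<in> set ?L"
      proof (cases two)
        case True
        then have "s = p \<or> s = n - p" using sp s two_iff[of p] sum[OF p] by auto
        then have "p = s \<or> p = n - s" using pI(5)[OF p] by linarith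
        then show ?thesis by auto
      next
        case False
        define t where "t = n - s"
        have st: "s + t = n" unfolding t_def using s by simp
        have Q: "p + 2 * q p = n \<or> p + 2 * q p + 1 = n" and R: "p + 2 * r p = n \<or> p + 2 * r p = n + 1"
        proof -
          have "n - p = q p + r p" using sum[OF p] by linarith
          then have "2 * q p = q p + r p \<or> 2 * q p + 1 = q p + r p" using three[OF False p] by metis
          then show "p + 2 * q p = n \<or> p + 2 * q p + 1 = n" "p + 2 * r p = n \<or> p + 2 * r p = n + 1"
            using sum[OF p] by (elim disjE; linarith)+
        qed
        define E where "E u \<longleftrightarrow> p = u \<or> p + 2 * u = n \<or> p + 2 * u + 1 = n \<or> p + 2 * u = n + 1" for u
        have EQ: "E p" "E (q p)" "E (r p)" using Q R unfolding E_def by blast+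
        have "(s = p \<or> s = q p \<or> s = r p) \<or> t = r p \<or> t = q p \<or> t = p"
          using sp sum[OF p] st by (elim disjE; linarith)
        then have "E s \<or> E t" using EQ by metis
        moreover have "E u \<Longrightarrow> p = u \<or> p = n - 2 * u \<or> p = n - 2 * u - 1 \<or> p = n + 1 - 2 * u" for u
          unfolding E_def by linarith
        ultimately have "(p = s \<or> p = n - 2 * s \<or> p = n - 2 * s - 1 \<or> p = n + 1 - 2 * s) \<or>
          (p = t \<or> p = n - 2 * t \<or> p = n - 2 * t - 1 \<or> p = n + 1 - 2 * t)" by blast
        then show ?thesis unfolding t_def by auto
      qed
    qed
    then have "card {p \<in> I. s \<in> {p, q p, r p, p + q p, p + r p, q p + r p}} \<le> length ?L" by (rule card_list_le)
    then show "card {p \<in> I. s \<in> {p, q p, r p, p + q p, p + r p, q p + r p}} \<le> 8" by simp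
  qed
  then show ?thesis unfolding I_def .
qed

text \<open>The cycle type (k, n - k) is odd because n is odd, so a proper subgroup containing it
  does not contain A_n and must have an invariant set.\<close>

lemma card_half_le_basic_set:
  assumes n: "prime n" "5 \<le> n" and B: "basic_set (sym_group n) B"
  shows "card {k. 2 \<le> k \<and> 2 * k < n} \<le> card B"
proof -
  define I where "I = {k. 2 \<le> k \<and> 2 * k < n}"
  have G: "sym_or_alt n (sym_group n)" unfolding sym_or_alt_def by simp
  have fI: "finite I" by (rule finite_subset[of _ "{..n}"]) (auto simp: I_def)
  have odd: "odd n" using prime_odd_nat[OF n(1)] n(2) by simp
  have "\<exists>x. x \<in> carrier (sym_group n) \<and> (\<exists>us vs ws. cycles3 {1..n} us vs ws x \<and>
        length us = k \<and> length vs = n - k \<and> length ws = 0)" if k: "k \<in> I" for k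
  proof -
    have "k + (n - k) + 0 = n" using k unfolding I_def by auto
    then obtain us vs ws x where "cycles3 {1..n} us vs ws x" "length us = k" "length vs = n - k" "length ws = 0"
      by (rule cycles3_exists)
    then show ?thesis using cycles3_permutes sym_group_carrier by blast
  qed
  then obtain x where x: "\<And>k. k \<in> I \<Longrightarrow> x k \<in> carrier (sym_group n) \<and> (\<exists>us vs ws. cycles3 {1..n} us vs ws (x k) \<and>
        length us = k \<and> length vs = n - k \<and> length ws = 0)" by metis
  have "card I \<le> 1 * card B"
  proof (rule card_le_basic_set[OF G B fI x])
    fix k H us vs ws y
    assume k: "k \<in> I" and H: "subgroup H (sym_group n)" "H \<noteq> carrier (sym_group n)" and y: "y \<in> H"
      and c: "cycles3 {1..n} us vs ws y" and len: "length us = k" "length vs = n - k" "length ws = 0"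
    have c': "cycles3 {1..n} us vs [] y" using c len by simp
    have "carrier (alt_group n) \<subseteq> H \<or> (\<exists>X. perm_group.invariant {1..n} H X \<and> X \<noteq> {} \<and> X \<noteq> {1..n})"
      using invariant_or_alt_if_prime_degree[OF perm_group_of_subgroup[OF G H(1)] c' y] k len n
      unfolding I_def by simp
    moreover have "odd (k - 1 + (n - k - 1))"
    proof -
      have odd_shift: "odd m" if "m + 2 = n" for m using that odd by auto
      show ?thesis by (rule odd_shift) (use k in \<open>auto simp: I_def\<close>)
    qed
    then have "\<not> evenperm y" using evenperm_cycles3[OF c] len by simp
    then have "\<not> carrier (alt_group n) \<subseteq> H"
      using subgroup_eq_if_alt_subset[OF G H(1) _ y] H(2) by blast
    ultimately show "\<exists>X. perm_group.invariant {1..n} H X \<and> X \<noteq> {} \<and> X \<noteq> {1..n}" by blast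
  next
    fix s assume "0 < s" "s < n"
    \<comment> \<open>The size s is k or n - k, and k is the smaller of the two, so s determines
      k.\<close>
    then have "{k \<in> I. s \<in> {k, n - k, 0, k + (n - k), k + 0, n - k + 0}} \<subseteq> set [if 2 * s < n then s else n - s]"
      by (auto simp: I_def)
    then have "card {k \<in> I. s \<in> {k, n - k, 0, k + (n - k), k + 0, n - k + 0}} \<le> length [if 2 * s < n then s else n - s]"
      by (rule card_list_le)
    then show "card {k \<in> I. s \<in> {k, n - k, 0, k + (n - k), k + 0, n - k + 0}} \<le> 1" by simp
  qed
  then show ?thesis unfolding I_def by simp
qed

section \<open>An upper bound for alternating groups of odd degree\<close>

lemma permutes_map_list:
  assumes "distinct xs" "distinct ys" "set xs = W" "set ys = W"
  obtains p where "p permutes W" "map p xs = ys"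
proof
  have len: "length xs = length ys" using assms distinct_card by metis
  define p where "p z = (if z \<in> W then the (map_of (zip xs ys) z) else z)" for z
  have nth: "p (xs ! i) = ys ! i" if "i < length xs" for i
    using that assms len map_of_zip_nth[OF len assms(1), of i] nth_mem[OF that] unfolding p_def by simp
  show map: "map p xs = ys" by (rule nth_equalityI) (use nth len in auto)
  have "p ` W = W" using map assms(3,4) by (metis set_map)
  then have "bij_betw p W W"
    using assms(3) by (metis List.finite_set bij_betw_def finite_surj_inj subset_refl)
  then show "p permutes W" by (rule bij_imp_permutes) (simp add: p_def)
qed

lemma support_invariant:
  assumes "g permutes W" "finite W" "a \<in> W"
  shows "a \<in> set (support g a)" "set (support g a) \<subseteq> W" "g ` set (support g a) = set (support g a)"
proof -
  have perm: "permutation g" using assms permutation_permutes by blast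
  note S = support_set[OF perm, of a]
  show "a \<in> set (support g a)" unfolding S by (rule range_eqI[of _ _ 0]) simp
  show "set (support g a) \<subseteq> W"
    unfolding S using permutes_in_image[OF permutes_funpow[OF assms(1)]] assms(3) by auto
  have "g ` set (support g a) \<subseteq> set (support g a)"
    unfolding S by (auto intro: range_eqI[of _ _ "Suc _"])
  then show "g ` set (support g a) = set (support g a)"
    by (rule endo_inj_surj[OF finite_set _ inj_on_subset[OF permutes_inj[OF assms(1)] subset_UNIV]])
qed

lemma invariant_Diff:
  assumes "g permutes W" "g ` X = X"
  shows "g ` (W - X) = W - X"
  using assms permutes_image[OF assms(1)] by (simp add: image_set_diff[OF permutes_inj[OF assms(1)]])

text \<open>An even permutation of an odd number of points does not have exactly two cycles.\<close>

lemma even_perm_cycle_or_small_invariant: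
  assumes g: "g permutes {1..n}" "evenperm g" and n: "odd n"
  obtains (cycle) L where "distinct L" "set L = {1..n}" "g = cycle_of_list L"
  | (invariant) X where "X \<subseteq> {1..n}" "g ` X = X" "1 \<le> card X" "3 * card X \<le> n"
proof -
  have perm: "permutation g" using g(1) permutation_permutes by blast
  have n0: "1 \<in> {1..n}" using n by (cases n) auto
  define K where "K = support g 1"
  note K = support_invariant[OF g(1) _ n0, folded K_def, simplified finite_atLeastAtMost]
  have dK: "distinct K" unfolding K_def by (rule cycle_of_permutation[OF perm])
  show ?thesis
  proof (cases "set K = {1..n}")
    case True
    have "g = cycle_of_list K"
    proof
      fix z show "g z = cycle_of_list K z"
        using cycle_restrict[OF perm, of z 1] True permutes_not_in[OF g(1), of z] id_outside_supp[of z K]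
        unfolding K_def by (cases "z \<in> {1..n}") auto
    qed
    then show ?thesis using cycle dK True by blast
  next
    case False
    then obtain y where y: "y \<in> {1..n}" "y \<notin> set K" using K(2) by blast
    define L where "L = support g y"
    note L = support_invariant[OF g(1) _ y(1), folded L_def, simplified finite_atLeastAtMost]
    have dL: "distinct L" unfolding L_def by (rule cycle_of_permutation[OF perm])
    have KL: "set K \<inter> set L = {}"
      using disjoint_support'[OF perm, of y 1] y(2) unfolding K_def L_def by blast
    \<comment> \<open>The cycles K and L and the rest Z are three invariant sets, so one has at most
      n / 3 points; Z is nonempty since two cycles alone would have the odd parity of n - 2.\<close>
    define Z where "Z = {1..n} - set K - set L"
    have gZ: "g ` Z = Z"
      using invariant_Diff[OF g(1), of "set K \<union> set L"] K(3) L(3) unfolding Z_def by (simp add: image_Un Diff_Un Diff_Int_distrib Diff_eq Int_assoc)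
    have Zne: "Z \<noteq> {}"
    proof
      assume "Z = {}"
      then have W: "set K \<union> set L = {1..n}" using K(2) L(2) unfolding Z_def by blast
      have "cycles3 {1..n} K L [] g"
        unfolding cycles3_def
      proof (intro conjI ext)
        show "distinct (K @ L @ [])" "set (K @ L @ []) = {1..n}" using dK dL KL W by auto
        fix z
        consider "z \<in> set K" "z \<notin> set L" | "z \<in> set L" "z \<notin> set K" | "z \<notin> {1..n}" using W KL by blast
        then show "g z = (cycle_of_list K \<circ> cycle_of_list L \<circ> cycle_of_list []) z"
        proof cases
          case 1
          then show ?thesis using cycle_restrict[OF perm, of z 1] unfolding K_def[symmetric] by (simp add: id_outside_supp)
        next
          case 2
          have "cycle_of_list L z \<in> set L" using 2(1) permutes_in_image[OF cycle_permutes, of L z] by blast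
          then have "cycle_of_list L z \<notin> set K" using KL by blast
          then show ?thesis using 2 cycle_restrict[OF perm, of z y] unfolding L_def[symmetric] by (simp add: id_outside_supp)
        next
          case 3
          then have "z \<notin> set K" "z \<notin> set L" using W by auto
          then show ?thesis using 3 permutes_not_in[OF g(1)] by (simp add: id_outside_supp)
        qed
      qed
      note c = this
      have "length K + length L = n" using cycles3_card[OF c] by simp
      moreover have "0 < length K" "0 < length L" using K(1) L(1) by auto
      ultimately have "length K - 1 + (length L - 1) + 2 = n" by linarith
      moreover have "odd m" if "m + 2 = n" for m using that n by auto
      ultimately have "odd (length K - 1 + (length L - 1))" by blast
      moreover have "even (length K - 1 + (length L - 1) + (length ([] :: nat list) - 1))"
        by (rule iffD1[OF evenperm_cycles3[OF c] g(2)])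
      ultimately show False by (simp only: list.size diff_0_eq_0 add_0_right)
    qed
    have fin: "finite Z" unfolding Z_def by simp
    have "{1..n} = set K \<union> set L \<union> Z" using K(2) L(2) unfolding Z_def by blast
    then have "n = card (set K \<union> set L \<union> Z)" by (metis card_atLeastAtMost diff_Suc_1)
    moreover have "(set K \<union> set L) \<inter> Z = {}" unfolding Z_def by blast
    ultimately have "n = card (set K) + card (set L) + card Z"
      using KL fin by (simp add: card_Un_disjoint)
    then consider "3 * card (set K) \<le> n" | "3 * card (set L) \<le> n" | "3 * card Z \<le> n" by linarith
    moreover have "1 \<le> card Z" using Zne fin by (simp add: Suc_le_eq card_gt_0_iff)
    moreover have "1 \<le> card (set K)" "1 \<le> card (set L)" using K(1) L(1) by (auto simp: Suc_le_eq card_gt_0_iff)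
    ultimately show ?thesis
      using invariant[of "set K"] invariant[of "set L"] invariant[of Z] K L gZ unfolding Z_def by blast
  qed
qed

section \<open>The subgroups that cover A_n\<close>

lemma conj_subgroup_alt_iff:
  assumes H: "subgroup H (alt_group n)" and s: "s \<in> carrier (alt_group n)" and g: "s \<circ> g \<circ> inv' s \<in> H"
  shows "g \<in> conj_subgroup (alt_group n) H s"
proof -
  interpret group "alt_group n" by (rule alt_group_is_group)
  have sp: "s permutes {1..n}" using s alt_group_carrier by blast
  have "inv\<^bsub>alt_group n\<^esub> s \<otimes>\<^bsub>alt_group n\<^esub> (s \<circ> g \<circ> inv' s) \<otimes>\<^bsub>alt_group n\<^esub> s = g"
    unfolding alt_group_inv_equality[OF s] alt_group_mult using permutes_inverses[OF sp] by (auto simp: fun_eq_iff)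
  then show ?thesis using conj_subgroup_iff[OF subgroup.subset[OF H] s] g by metis
qed

lemma cycle_in_alt:
  assumes "distinct cs" "set cs \<subseteq> {1..n}" "odd (length cs)"
  shows "cycle_of_list cs \<in> carrier (alt_group n)"
  using assms evenperm_cycle[OF assms(1)] permutes_subset[OF cycle_permutes assms(2)]
  by (simp add: alt_group_carrier)

text \<open>Take e outside {a, h a, h (h a)}. The three-cycle on a, h a, e followed by h sends a to
  h (h a), but h followed by the three-cycle sends a to e.\<close>

lemma centralizer_alt_proper:
  assumes h: "h permutes {1..n}" "h a \<noteq> a" and n: "4 \<le> n"
  shows "centralizer (alt_group n) h \<noteq> carrier (alt_group n)"
proof
  assume eq: "centralizer (alt_group n) h = carrier (alt_group n)"
  have a: "a \<in> {1..n}" "h a \<in> {1..n}" using h permutes_not_in permutes_in_image by metis+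
  have "card {a, h a, h (h a)} < card {1..n}"
    using n card_length[of "[a, h a, h (h a)]"] by simp
  then have "\<not> {1..n} \<subseteq> {a, h a, h (h a)}" by (metis card_mono finite.emptyI finite.insertI not_le)
  then obtain e where e: "e \<in> {1..n}" "e \<notin> {a, h a, h (h a)}" by blast
  have d: "distinct [a, h a, e]" using h(2) e by auto
  have "cycle_of_list [a, h a, e] \<in> centralizer (alt_group n) h"
    unfolding eq by (rule cycle_in_alt) (use d a e in auto)
  then have "cycle_of_list [a, h a, e] \<circ> h = h \<circ> cycle_of_list [a, h a, e]"
    unfolding centralizer_def alt_group_mult by blast
  then have "cycle_of_list [a, h a, e] (h a) = h (cycle_of_list [a, h a, e] a)" by (metis comp_apply)
  then show False using three_cycle_apply[OF d] h(2) e by simp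
qed

text \<open>One set per size suffices, since an even permutation carries any k-set with k + 2 <= n
  onto {1..k}.\<close>

definition alt_stabilizer :: "nat \<Rightarrow> nat \<Rightarrow> (nat \<Rightarrow> nat) set" where
  "alt_stabilizer n k = {g \<in> carrier (alt_group n). g ` {1..k} = {1..k}}"

lemma alt_stabilizer_subgroup: "subgroup (alt_stabilizer n k) (alt_group n)"
proof -
  interpret group "alt_group n" by (rule alt_group_is_group)
  show ?thesis
  proof (rule subgroupI)
    show "alt_stabilizer n k \<subseteq> carrier (alt_group n)" unfolding alt_stabilizer_def by blast
    show "alt_stabilizer n k \<noteq> {}"
      using one_closed unfolding alt_stabilizer_def alt_group_one by force
    show "inv\<^bsub>alt_group n\<^esub> g \<in> alt_stabilizer n k" if "g \<in> alt_stabilizer n k" for g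
    proof -
      have g: "g \<in> carrier (alt_group n)" "g ` {1..k} = {1..k}" using that unfolding alt_stabilizer_def by auto
      have "inj g" using g(1) permutes_inj unfolding alt_group_carrier by blast
      then have "inv' g ` (g ` {1..k}) = {1..k}" by (simp add: image_comp)
      then show ?thesis using g inv_closed[OF g(1)] unfolding alt_stabilizer_def alt_group_inv_equality[OF g(1)] by simp
    qed
    show "g \<otimes>\<^bsub>alt_group n\<^esub> h \<in> alt_stabilizer n k" if "g \<in> alt_stabilizer n k" "h \<in> alt_stabilizer n k" for g h
    proof -
      have gh: "g \<in> carrier (alt_group n)" "g ` {1..k} = {1..k}" "h \<in> carrier (alt_group n)" "h ` {1..k} = {1..k}"
        using that unfolding alt_stabilizer_def by auto
      then have "(g \<circ> h) ` {1..k} = {1..k}" by (metis image_comp)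
      then show ?thesis using m_closed[OF gh(1,3)] unfolding alt_stabilizer_def alt_group_mult by blast
    qed
  qed
qed

text \<open>Two points outside {1..k} leave room for an even permutation, a three-cycle, that moves
  1 out of {1..k}.\<close>

lemma alt_stabilizer_proper:
  assumes "1 \<le> k" "k + 2 \<le> n"
  shows "alt_stabilizer n k \<noteq> carrier (alt_group n)"
proof
  assume eq: "alt_stabilizer n k = carrier (alt_group n)"
  have d: "distinct [1, n, n - 1]" using assms by auto
  have "cycle_of_list [1, n, n - 1] \<in> alt_stabilizer n k"
    unfolding eq by (rule cycle_in_alt) (use d assms in auto)
  then have "cycle_of_list [1, n, n - 1] 1 \<in> {1..k}" using assms(1) unfolding alt_stabilizer_def by fastforce
  then show False using three_cycle_apply[OF d] assms by simp
qed

text \<open>Any bijection carrying X to the initial segment can be corrected in parity by swapping n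
  - 1 and n, which lie beyond the segment.\<close>

lemma even_perm_to_initial:
  assumes X: "X \<subseteq> {1..n}" "card X + 2 \<le> n"
  obtains s where "s \<in> carrier (alt_group n)" "s ` X = {1..card X}"
proof -
  have fX: "finite X" using X finite_subset by blast
  obtain xs where xs: "set xs = X" "distinct xs" using finite_distinct_list[OF fX] by blast
  obtain ys where ys: "set ys = {1..n} - X" "distinct ys" using finite_distinct_list[of "{1..n} - X"] by blast
  have len: "length xs = card X" using xs distinct_card by metis
  obtain s where s: "s permutes {1..n}" "map s (xs @ ys) = [1..<Suc n]"
    by (rule permutes_map_list[of "xs @ ys" "[1..<Suc n]" "{1..n}"]) (use xs ys X in auto)
  have "map s xs = take (card X) [1..<Suc n]" using s(2) len by (metis append_eq_conv_conj length_map map_append)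
  also have "\<dots> = [1..<Suc (card X)]" using X(2) by (simp add: take_upt del: upt_Suc)
  finally have sX: "s ` X = {1..card X}" using xs(1) by (metis set_map atLeastLessThanSuc_atLeastAtMost set_upt)
  show ?thesis
  proof (cases "evenperm s")
    case True
    then show ?thesis using that s(1) sX alt_group_carrier by blast
  next
    case False
    define t where "t = transpose (n - 1) n"
    have tp: "t permutes {1..n}" unfolding t_def using X(2) by (intro permutes_swap_id) auto
    have "\<not> evenperm t" unfolding t_def evenperm_swap using X(2) by auto
    then have "evenperm (t \<circ> s)"
      using False evenperm_comp[of t s] tp s(1) permutation_permutes by blast
    moreover have "t \<circ> s permutes {1..n}" using s(1) tp by (rule permutes_compose)
    moreover have "t ` {1..card X} = {1..card X}"
      unfolding t_def using X(2) by (subst transpose_image_eq) auto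
    then have "(t \<circ> s) ` X = {1..card X}" using sX by (metis image_comp)
    ultimately show ?thesis using that alt_group_carrier by blast
  qed
qed

text \<open>Set stabilizers for the sizes up to n / 3 catch every element with a small invariant
  set; the remaining elements are n-cycles, for which two centralizers suffice.\<close>

lemma gamma_num_alt_le:
  assumes n: "odd n" "5 \<le> n"
  shows "gamma_num (alt_group n) \<le> n div 3 + 2"
proof -
  interpret group "alt_group n" by (rule alt_group_is_group)
  define L where "L = [1..<Suc n]"
  \<comment> \<open>Conjugation by the odd t takes c to c'. An n-cycle that an odd s conjugates to c
    is conjugated to c' by the even \<open>t \<circ> s\<close>.\<close>
  define t :: "nat \<Rightarrow> nat" where "t = transpose 1 2"
  have L: "distinct L" "set L = {1..n}" "length L = n" unfolding L_def by auto
  have tp: "t permutes {1..n}" unfolding t_def using n by (intro permutes_swap_id) auto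
  have L': "distinct (map t L)" "set (map t L) = {1..n}"
    using L permutes_image[OF tp] permutes_inj_on[OF tp] by (auto simp: distinct_map)
  define c where "c = cycle_of_list L"
  define c' where "c' = cycle_of_list (map t L)"
  have cc: "c \<in> carrier (alt_group n)" "c' \<in> carrier (alt_group n)"
    unfolding c_def c'_def by (rule cycle_in_alt; use L L' n in simp)+
  have proper: "centralizer (alt_group n) (cycle_of_list M) \<noteq> carrier (alt_group n)"
    if M: "distinct M" "set M = {1..n}" for M
  proof (rule centralizer_alt_proper)
    show "cycle_of_list M permutes {1..n}" using cycle_permutes[of M] M(2) by simp
    have len: "length M = n" using distinct_card[OF M(1)] M(2) by simp
    have "cycle_of_list M (M ! 0) = M ! 1" using cycle_funpow_nth[OF M(1), of 0 1] len n by simp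
    then show "cycle_of_list M (M ! 0) \<noteq> M ! 0" using M(1) len n by (simp add: nth_eq_iff_index_eq)
    show "4 \<le> n" using n by simp
  qed
  define F where "F = alt_stabilizer n ` {1..n div 3} \<union> {centralizer (alt_group n) c, centralizer (alt_group n) c'}"
  have fF: "finite F" unfolding F_def by simp
  have small: "k + 2 \<le> n" if "3 * k \<le> n" for k using that n(2) by linarith
  have F: "subgroup H (alt_group n) \<and> H \<noteq> carrier (alt_group n)" if "H \<in> F" for H
  proof -
    from that consider k where "1 \<le> k" "k \<le> n div 3" "H = alt_stabilizer n k"
      | "H = centralizer (alt_group n) c" | "H = centralizer (alt_group n) c'"
      unfolding F_def by auto
    then show ?thesis
    proof cases
      case 1
      then have "3 * k \<le> n" by linarith
      then show ?thesis using alt_stabilizer_subgroup alt_stabilizer_proper small 1 by simp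
    qed (use centralizer_subgroup cc proper[OF L(1,2)] proper[OF L'] in \<open>auto simp: c_def c'_def\<close>)
  qed
  have "\<exists>H\<in>F. \<exists>s\<in>carrier (alt_group n). g \<in> conj_subgroup (alt_group n) H s"
    if "g \<in> carrier (alt_group n)" for g
  proof -
    have g: "g permutes {1..n}" "evenperm g" using that alt_group_carrier by blast+
    from g n(1) show ?thesis
    proof (cases rule: even_perm_cycle_or_small_invariant)
      case (cycle M)
      obtain s where s: "s permutes {1..n}" "map s M = L"
        by (rule permutes_map_list[OF cycle(1) L(1) cycle(2) L(2)])
      have sg: "s \<circ> g \<circ> inv' s = c"
        unfolding cycle(3) c_def using conjugation_of_cycle[OF cycle(1) permutes_bij[OF s(1)]] s(2) by simp
      show ?thesis
      proof (cases "evenperm s")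
        case True
        then have sa: "s \<in> carrier (alt_group n)" using s(1) alt_group_carrier by blast
        have "c \<in> centralizer (alt_group n) c" using cc unfolding centralizer_def by blast
        then have "g \<in> conj_subgroup (alt_group n) (centralizer (alt_group n) c) s"
          using conj_subgroup_alt_iff[OF centralizer_subgroup[OF cc(1)] sa] sg by simp
        then show ?thesis using sa unfolding F_def by blast
      next
        case False
        have "\<not> evenperm t" unfolding t_def evenperm_swap by simp
        then have "evenperm (t \<circ> s)"
          using False evenperm_comp[of t s] tp s(1) permutation_permutes by blast
        moreover have "t \<circ> s permutes {1..n}" using s(1) tp by (rule permutes_compose)
        ultimately have sa: "t \<circ> s \<in> carrier (alt_group n)" using alt_group_carrier by blast
        have "map (t \<circ> s) M = map t L" using s(2) by (metis map_map)
        then have tsg: "(t \<circ> s) \<circ> g \<circ> inv' (t \<circ> s) = c'"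
          unfolding cycle(3) c'_def using conjugation_of_cycle[OF cycle(1) permutes_bij[OF \<open>t \<circ> s permutes {1..n}\<close>]] by simp
        have "c' \<in> centralizer (alt_group n) c'" using cc unfolding centralizer_def by blast
        then have "g \<in> conj_subgroup (alt_group n) (centralizer (alt_group n) c') (t \<circ> s)"
          using conj_subgroup_alt_iff[OF centralizer_subgroup[OF cc(2)] sa] tsg by simp
        then show ?thesis using sa unfolding F_def by blast
      qed
    next
      case (invariant X)
      obtain s where s: "s \<in> carrier (alt_group n)" "s ` X = {1..card X}"
        using even_perm_to_initial[OF invariant(1) small[OF invariant(4)]] .
      have sp: "s permutes {1..n}" using s(1) alt_group_carrier by blast
      have "inv' s ` {1..card X} = X" using s(2) permutes_inj[OF sp] by (metis image_inv_f_f)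
      then have "(s \<circ> g \<circ> inv' s) ` {1..card X} = {1..card X}"
        using s(2) invariant(2) by (metis image_comp)
      moreover have "s \<circ> g \<circ> inv' s \<in> carrier (alt_group n)"
        using s(1) that m_closed inv_closed unfolding alt_group_mult alt_group_inv_equality[OF s(1), symmetric] by blast
      ultimately have "s \<circ> g \<circ> inv' s \<in> alt_stabilizer n (card X)" unfolding alt_stabilizer_def by blast
      then have "g \<in> conj_subgroup (alt_group n) (alt_stabilizer n (card X)) s"
        by (rule conj_subgroup_alt_iff[OF alt_stabilizer_subgroup s(1)])
      moreover have "alt_stabilizer n (card X) \<in> F"
        using invariant(3,4) unfolding F_def by (intro UnI1 imageI) auto
      ultimately show ?thesis using s(1) by blast
    qed
  qed
  then have "normal_cover (alt_group n) F"
    unfolding normal_cover_def using fF F by blast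
  then have "gamma_num (alt_group n) \<le> card F" by (rule gamma_num_le)
  also have "\<dots> \<le> card (alt_stabilizer n ` {1..n div 3}) + card {centralizer (alt_group n) c, centralizer (alt_group n) c'}"
    unfolding F_def by (rule card_Un_le)
  also have "\<dots> \<le> n div 3 + 2"
    using card_image_le[of "{1..n div 3}" "alt_stabilizer n"] card_length[of "[centralizer (alt_group n) c, centralizer (alt_group n) c']"]
    by simp
  finally show ?thesis .
qed

section \<open>Asymptotics\<close>

text \<open>The three-cycles on 1, 2, 3 and on 1, 2, 4 lie in both groups and do not
  commute.\<close>

lemma gamma_num_attained_sym_or_alt:
  assumes G: "sym_or_alt n G" and n: "4 \<le> n"
  obtains B where "basic_set G B" "card B = gamma_num G"
proof -
  interpret group G by (rule sym_or_alt_group[OF G])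
  let ?g = "cycle_of_list [1, 2, 3] :: nat \<Rightarrow> nat" and ?h = "cycle_of_list [1, 2, 4] :: nat \<Rightarrow> nat"
  have even3: "cycle_of_list cs \<in> carrier G" if cs: "cs \<in> {[1, 2, 3], [1, 2, 4]}" for cs :: "nat list"
  proof -
    have "cycle_of_list cs permutes {1..n}"
      using n cs by (intro permutes_subset[OF cycle_permutes]) auto
    moreover have "evenperm (cycle_of_list cs)" using cs evenperm_cycle[of cs] by auto
    ultimately show ?thesis using G unfolding sym_or_alt_def by (auto simp: sym_group_carrier alt_group_carrier)
  qed
  have gh: "?g \<in> carrier G" "?h \<in> carrier G" by (rule even3; simp)+
  have d: "distinct [1::nat, 2, 3]" "distinct [1::nat, 2, 4]" by simp_all
  have "(?g \<circ> ?h) 1 \<noteq> (?h \<circ> ?g) 1"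
    unfolding comp_apply three_cycle_apply[OF d(1)] three_cycle_apply[OF d(2)] by simp
  then have "?g \<otimes>\<^bsub>G\<^esub> ?h \<noteq> ?h \<otimes>\<^bsub>G\<^esub> ?g" unfolding sym_or_alt_simps(1)[OF G] by metis
  then show ?thesis using gamma_num_attained[OF sym_or_alt_finite[OF G] gh] that by blast
qed

lemma gamma_num_at_top:
  assumes G: "\<And>n. sym_or_alt n (G n)"
  shows "filterlim (\<lambda>n. gamma_num (G n)) at_top sequentially"
  unfolding filterlim_at_top
proof
  fix K :: nat
  obtain n0 :: nat where n0: "\<And>n N. n0 \<le> n \<Longrightarrow> 0 < N \<Longrightarrow> N \<le> n ^ 3 \<Longrightarrow>
      8 * K < card {p. prime p \<and> \<not> p dvd N \<and> 4 * p \<le> n}"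
    \<comment> \<open>The 8 cancels the fibre bound of
      \<open>card_primes_le_basic_set\<close>.\<close>
    using many_primes_not_dividing[of "8 * K"] by blast
  have "K \<le> gamma_num (G n)" if n: "n0 + 4 \<le> n" for n
  proof -
    obtain B where B: "basic_set (G n) B" "card B = gamma_num (G n)"
      using gamma_num_attained_sym_or_alt[OF G, of n] n by auto
    have "(n - 1) * (n + 1) \<le> n * n" by (cases n) auto
    then have "((n - 1) * (n + 1)) * n \<le> n ^ 3" unfolding power3_eq_cube by (rule mult_le_mono1)
    moreover have "(n - 1) * n * (n + 1) = ((n - 1) * (n + 1)) * n" by (simp only: ac_simps)
    ultimately have N: "(n - 1) * n * (n + 1) \<le> n ^ 3" by (simp only:)
    have "0 < (n - 1) * n * (n + 1)" using n by simp
    then have "8 * K < card {p. prime p \<and> \<not> p dvd (n - 1) * n * (n + 1) \<and> 4 * p \<le> n}"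
      using n by (intro n0 N) auto
    also have "\<dots> \<le> 8 * card B" by (rule card_primes_le_basic_set[OF G _ B(1)]) (use n in simp)
    finally show ?thesis using B(2) by simp
  qed
  then show "eventually (\<lambda>n. K \<le> gamma_num (G n)) sequentially"
    by (rule eventually_sequentiallyI)
qed

lemma gamma_num_sym_ge:
  assumes "prime n" "5 \<le> n"
  shows "n \<le> 2 * gamma_num (sym_group n) + 3"
proof -
  obtain B where B: "basic_set (sym_group n) B" "card B = gamma_num (sym_group n)"
    using gamma_num_attained_sym_or_alt[of n "sym_group n"] assms by (auto simp: sym_or_alt_def)
  have "{k. 2 \<le> k \<and> 2 * k < n} = {2..<(n + 1) div 2}" by auto
  then have "(n + 1) div 2 - 2 \<le> gamma_num (sym_group n)"
    using card_half_le_basic_set[OF assms B(1)] B(2) by simp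
  moreover have "odd n" using prime_odd_nat assms by simp
  then have "2 * ((n + 1) div 2) = n + 1" by simp
  ultimately show ?thesis by linarith
qed

lemma finite_fibre_if_at_top:
  fixes f :: "nat \<Rightarrow> nat"
  assumes "filterlim f at_top sequentially"
  shows "finite {n. m \<le> n \<and> f n = k}"
proof -
  obtain N where "\<And>n. N \<le> n \<Longrightarrow> Suc k \<le> f n"
    using assms unfolding filterlim_at_top eventually_sequentially by blast
  then have "{n. m \<le> n \<and> f n = k} \<subseteq> {..<N}" by (auto simp: not_le[symmetric]) (metis not_less_eq_eq order_refl)
  then show ?thesis by (rule finite_subset) simp
qed

theorem corollaryC:
  shows "(filterlim (\<lambda>n. gamma_num (sym_group n)) at_top sequentially \<and>
          filterlim (\<lambda>n. gamma_num (alt_group n)) at_top sequentially \<and>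
          (\<forall>k\<ge>2. finite {n. n \<ge> 3 \<and> gamma_num (sym_group n) = k}) \<and>
          (\<forall>k\<ge>2. finite {n. n \<ge> 4 \<and> gamma_num (alt_group n) = k})) \<and>
         limsup (\<lambda>n. ereal (real (gamma_num (sym_group n)) - real (gamma_num (alt_group n)))) = \<infinity>"
proof -
  have S: "filterlim (\<lambda>n. gamma_num (sym_group n)) at_top sequentially"
    and A: "filterlim (\<lambda>n. gamma_num (alt_group n)) at_top sequentially"
    by (intro gamma_num_at_top; simp add: sym_or_alt_def)+
  define d where "d n = real (gamma_num (sym_group n)) - real (gamma_num (alt_group n))" for n
  have unbounded: "\<exists>n\<ge>N. K < d n" for N :: nat and K :: real
  proof -
    \<comment> \<open>For prime n the two bounds give 6 gamma(S_n) >= 3 n - 9 and 6 gamma(A_n) <= 2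
      n + 12, so 6 d n >= n - 21.\<close>
    obtain n where n: "prime n" "N + 5 + nat \<lceil>6 * K + 22\<rceil> < n" using bigger_prime by blast
    then have "odd n" using prime_odd_nat by simp
    then have "3 * gamma_num (alt_group n) \<le> n + 6" using gamma_num_alt_le[of n] n(2) by linarith
    moreover have "n \<le> 2 * gamma_num (sym_group n) + 3" using gamma_num_sym_ge n by simp
    ultimately have "real (3 * gamma_num (alt_group n)) \<le> real (n + 6)"
      "real n \<le> real (2 * gamma_num (sym_group n) + 3)" by (simp_all only: of_nat_le_iff)
    then have "real n - 21 \<le> 6 * d n" unfolding d_def by simp
    moreover have "6 * K + 22 \<le> real n" using n(2) by linarith
    ultimately have "K < d n" by linarith
    then show ?thesis using n(2) by (intro exI[of _ n]) simp
  qed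
  have "limsup (\<lambda>n. ereal (d n)) = \<infinity>"
  proof (rule ccontr)
    assume "limsup (\<lambda>n. ereal (d n)) \<noteq> \<infinity>"
    \<comment> \<open>A limsup below infinity lies below some natural number K and would bound d n
      by K for all large n.\<close>
    then obtain K :: nat where "limsup (\<lambda>n. ereal (d n)) < ereal (real K)"
      using less_PInf_Ex_of_nat by blast
    then have "\<forall>\<^sub>F n in sequentially. ereal (d n) < ereal (real K)" by (rule Limsup_lessD)
    then obtain N where "\<And>n. N \<le> n \<Longrightarrow> d n < real K"
      unfolding eventually_sequentially by auto
    then show False using unbounded[of N "real K"] by fastforce
  qed
  then show ?thesis
    using S A finite_fibre_if_at_top[OF S] finite_fibre_if_at_top[OF A] unfolding d_def by simp
qed

end
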